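(* Let $H$ be a Hopf algebra over a field $\Bbbk$ with bijective antipode. Then the canonical braiding $\psi$ of the Yetter-Drinfel'd-Long category $\mathcal{LR}(H)$ is a symmetry, i.e. $\psi_{N,M}\circ\psi_{M,N}=\mathrm{id}_{M\otimes N}$ for all $M,N\in\mathcal{LR}(H)$, if and only if $H=\Bbbk$.
   Context: Everything is over a field $\Bbbk$; Sweedler notation $\Delta(h)=h_1\otimes h_2$ is used with summation omitted. A Yetter-Drinfel'd-Long bimodule over a Hopf algebra $H$ is a vector space $M$ which is an $H$-bimodule (left action $h\otimes m\mapsto h\triangleright m$, right action $m\otimes h\mapsto m\triangleleft h$, with $(a\triangleright m)\triangleleft b=a\triangleright(m\triangleleft b)$) and an $H$-bicomodule (left coaction $m\mapsto m_{[-1]}\otimes m_{[0]}\in H\otimes M$, right coaction $m\mapsto m_{(0)}\otimes m_{(1)}\in M\otimes H$, with $m_{[-1]}\otimes m_{[0](0)}\otimes m_{[0](1)}=m_{(0)[-1]}\otimes m_{(0)[0]}\otimes m_{(1)}$), such that for all $h\in H$, $m\in M$: $(h_1\triangleright m)_{[-1]}h_2\otimes(h_1\triangleright m)_{[0]}=h_1m_{[-1]}\otimes h_2\triangleright m_{[0]}$; $(h\triangleright m)_{(0)}\otimes(h\triangleright m)_{(1)}=h\triangleright m_{(0)}\otimes m_{(1)}$; $(m\triangleleft h_2)_{(0)}\otimes h_1(m\triangleleft h_2)_{(1)}=m_{(0)}\triangleleft h_1\otimes m_{(1)}h_2$; $(m\triangleleft h)_{[-1]}\otimes(m\triangleleft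 h)_{[0]}=m_{[-1]}\otimes m_{[0]}\triangleleft h$. $\mathcal{LR}(H)$ is the category of Yetter-Drinfel'd-Long bimodules over $H$, with morphisms the $H$-bilinear and $H$-bicolinear maps. If the antipode of $H$ is bijective it is a (strict) braided monoidal category with $h\triangleright(m\otimes n)=h_1\triangleright m\otimes h_2\triangleright n$, $(m\otimes n)\triangleleft h=m\triangleleft h_1\otimes n\triangleleft h_2$, $(m\otimes n)_{[-1]}\otimes(m\otimes n)_{[0]}=m_{[-1]}n_{[-1]}\otimes m_{[0]}\otimes n_{[0]}$, $(m\otimes n)_{(0)}\otimes(m\otimes n)_{(1)}=m_{(0)}\otimes n_{(0)}\otimes m_{(1)}n_{(1)}$, and canonical braiding $\psi_{M,N}:M\otimes N\to N\otimes M$, $\psi_{M,N}(m\otimes n)=m_{[-1]}\triangleright n_{(0)}\otimes m_{[0]}\triangleleft n_{(1)}$. "$H=\Bbbk$" means that $H$ is the trivial (one-dimensional) Hopf algebra. *)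

theory Defs
  imports Complex_Main "HOL-Library.Function_Algebras"
begin

section \<open>Vector spaces and tensor products over an arbitrary field\<close>

text \<open>
  A vector space is a subspace \<^term>\<open>vcarrier V\<close> of an abelian group type, on which
  \<^term>\<open>vscale V\<close> is a scalar multiplication.
\<close>

record ('k, 'a) vsp =
  vscale :: "'k \<Rightarrow> 'a \<Rightarrow> 'a"
  vcarrier :: "'a set"

definition vspace :: "('k::field, 'a::ab_group_add, 'x) vsp_scheme \<Rightarrow> bool" where
  "vspace V \<longleftrightarrow> vector_space (vscale V) \<and> module.subspace (vscale V) (vcarrier V)"

definition linear_on ::
  "('k::field, 'a::ab_group_add, 'x) vsp_scheme \<Rightarrow> ('k \<Rightarrow> 'b::ab_group_add \<Rightarrow> 'b) \<Rightarrow> ('a \<Rightarrow> 'b) \<Rightarrow> bool" where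
  "linear_on V s f \<longleftrightarrow>
     (\<forall>x \<in> vcarrier V. \<forall>y \<in> vcarrier V. f (x + y) = f x + f y) \<and>
     (\<forall>c. \<forall>x \<in> vcarrier V. f (vscale V c x) = s c (f x))"

definition bilinear_on ::
  "('k::field, 'a::ab_group_add, 'x) vsp_scheme \<Rightarrow> ('k, 'b::ab_group_add, 'y) vsp_scheme \<Rightarrow>
   ('k \<Rightarrow> 'c::ab_group_add \<Rightarrow> 'c) \<Rightarrow> ('a \<Rightarrow> 'b \<Rightarrow> 'c) \<Rightarrow> bool" where
  "bilinear_on V W s \<phi> \<longleftrightarrow>
     (\<forall>w \<in> vcarrier W. linear_on V s (\<lambda>v. \<phi> v w)) \<and>
     (\<forall>v \<in> vcarrier V. linear_on W s (\<phi> v))"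

text \<open>
  Over a field, the tensor product of V and W is the space of those functionals on the bilinear
  forms on V and W that are spanned by the evaluations at pairs (v, w).  The evaluation at (v, w)
  is the pure tensor of v and w. That this has the universal property of the tensor product is
  proved below (\<open>sweedler_pure\<close>, \<open>sweedler_linear\<close>; uniqueness is clear, since the pure tensors span).
\<close>

type_synonym ('k, 'a, 'b) tensor = "('a \<Rightarrow> 'b \<Rightarrow> 'k) \<Rightarrow> 'k"

definition tscale :: "'k::field \<Rightarrow> ('i \<Rightarrow> 'k) \<Rightarrow> ('i \<Rightarrow> 'k)" where
  "tscale c t = (\<lambda>\<beta>. c * t \<beta>)"

definition pure ::
  "('k::field, 'a::ab_group_add, 'x) vsp_scheme \<Rightarrow> ('k, 'b::ab_group_add, 'y) vsp_scheme \<Rightarrow>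
   'a \<Rightarrow> 'b \<Rightarrow> ('k, 'a, 'b) tensor" where
  "pure V W v w = (\<lambda>\<beta>. if bilinear_on V W (*) \<beta> then \<beta> v w else 0)"

definition tensor_space ::
  "('k::field, 'a::ab_group_add, 'x) vsp_scheme \<Rightarrow> ('k, 'b::ab_group_add, 'y) vsp_scheme \<Rightarrow>
   ('k, ('k, 'a, 'b) tensor) vsp"  (infixr \<open>\<otimes>\<^sub>v\<close> 70) where
  "V \<otimes>\<^sub>v W =
     \<lparr>vscale = tscale,
      vcarrier = module.span tscale {pure V W v w | v w. v \<in> vcarrier V \<and> w \<in> vcarrier W}\<rparr>"

text \<open>
  \<^term>\<open>sweedler V W t \<phi>\<close> is Sweedler notation: it is the sum of all \<open>\<phi> t\<^sub>1 t\<^sub>2\<close> for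
  \<open>t = t\<^sub>1 \<otimes> t\<^sub>2\<close> (summation omitted).  It is computed from an arbitrary decomposition of t into
  pure tensors with entries in V and W, and independent of it if \<open>\<phi>\<close> is bilinear.
\<close>

definition sweedler ::
  "('k::field, 'a::ab_group_add, 'x) vsp_scheme \<Rightarrow> ('k, 'b::ab_group_add, 'y) vsp_scheme \<Rightarrow>
   ('k, 'a, 'b) tensor \<Rightarrow> ('a \<Rightarrow> 'b \<Rightarrow> 'c::ab_group_add) \<Rightarrow> 'c" where
  "sweedler V W t \<phi> =
     (let ps = (SOME ps. set ps \<subseteq> vcarrier V \<times> vcarrier W \<and> t = (\<Sum>(v, w)\<leftarrow>ps. pure V W v w))
      in (\<Sum>(v, w)\<leftarrow>ps. \<phi> v w))"

lemma vector_space_tscale: "vector_space tscale"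
  by unfold_locales (auto simp: tscale_def fun_eq_iff algebra_simps)

lemma vector_space_times: "vector_space ((*) :: 'k::field \<Rightarrow> 'k \<Rightarrow> 'k)"
  by unfold_locales (auto simp: algebra_simps)

lemma vspace_tensor_space: "vspace (V \<otimes>\<^sub>v W)"
proof -
  interpret vector_space tscale by (rule vector_space_tscale)
  show ?thesis
    by (simp add: vspace_def tensor_space_def vector_space_tscale subspace_span)
qed

lemma pure_in_tensor_space:
  "v \<in> vcarrier V \<Longrightarrow> w \<in> vcarrier W \<Longrightarrow> pure V W v w \<in> vcarrier (V \<otimes>\<^sub>v W)"
proof -
  interpret vector_space tscale by (rule vector_space_tscale)
  show "v \<in> vcarrier V \<Longrightarrow> w \<in> vcarrier W \<Longrightarrow> pure V W v w \<in> vcarrier (V \<otimes>\<^sub>v W)"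
    by (auto simp: tensor_space_def intro!: span_base)
qed

lemma bilinear_on_pure: "bilinear_on V W tscale (pure V W)"
  unfolding bilinear_on_def linear_on_def
  by (auto simp: pure_def tscale_def fun_eq_iff bilinear_on_def linear_on_def)

lemma sum_pure_apply:
  "bilinear_on V W (*) \<beta> \<Longrightarrow> (\<Sum>(v, w)\<leftarrow>ps. pure V W v w) \<beta> = (\<Sum>(v, w)\<leftarrow>ps. \<beta> v w)"
  by (induction ps) (auto simp: pure_def)

lemma tensor_space_decomp:
  assumes V: "vspace V" and t: "t \<in> vcarrier (V \<otimes>\<^sub>v W)"
  shows "\<exists>ps. set ps \<subseteq> vcarrier V \<times> vcarrier W \<and> t = (\<Sum>(v, w)\<leftarrow>ps. pure V W v w)"
proof -
  interpret vector_space tscale by (rule vector_space_tscale)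
  interpret V: vector_space "vscale V" using V by (simp add: vspace_def)
  have "t \<in> span {pure V W v w | v w. v \<in> vcarrier V \<and> w \<in> vcarrier W}"
    using t by (simp add: tensor_space_def)
  then show ?thesis
  proof (induction rule: span_induct_alt)
    case base
    show ?case by (rule exI[of _ "[]"]) simp
  next
    case (step c x y)
    then obtain v w ps where *: "v \<in> vcarrier V" "w \<in> vcarrier W" "x = pure V W v w"
      "set ps \<subseteq> vcarrier V \<times> vcarrier W" "y = (\<Sum>(v, w)\<leftarrow>ps. pure V W v w)" by blast
    have "vscale V c v \<in> vcarrier V"
      using V * by (simp add: vspace_def V.subspace_scale)
    moreover have "pure V W (vscale V c v) w = tscale c (pure V W v w)"
      using bilinear_on_pure[of V W] * by (simp add: bilinear_on_def linear_on_def)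
    ultimately show ?case using *
      by (intro exI[of _ "(vscale V c v, w) # ps"]) simp
  qed
qed

lemma functional_separates:
  assumes "vector_space (s :: 'k::field \<Rightarrow> 'a::ab_group_add \<Rightarrow> 'a)" "x \<noteq> 0"
  obtains f where "Vector_Spaces.linear s ((*) :: 'k \<Rightarrow> 'k \<Rightarrow> 'k) f" "f x \<noteq> 0"
proof -
  interpret vector_space_pair s "(*) :: 'k \<Rightarrow> 'k \<Rightarrow> 'k"
    using assms(1) vector_space_times by (simp add: vector_space_pair_def)
  have "vs1.independent {x}" using assms(2) by simp
  from linear_independent_extend[OF this, of "\<lambda>_. 1"] that show thesis by auto
qed

lemma sum_pure_eq:
  assumes s: "vector_space s" and \<phi>: "bilinear_on V W s \<phi>"
    and eq: "(\<Sum>(v, w)\<leftarrow>ps. pure V W v w) = (\<Sum>(v, w)\<leftarrow>qs. pure V W v w)"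
  shows "(\<Sum>(v, w)\<leftarrow>ps. \<phi> v w) = (\<Sum>(v, w)\<leftarrow>qs. \<phi> v w)"
proof (rule ccontr)
  let ?d = "(\<Sum>(v, w)\<leftarrow>ps. \<phi> v w) - (\<Sum>(v, w)\<leftarrow>qs. \<phi> v w)"
  assume "\<not> ?thesis"
  then have "?d \<noteq> 0" by simp
  from functional_separates[OF s this] obtain f
    where f: "Vector_Spaces.linear s (*) f" and nz: "f ?d \<noteq> 0" by blast
  interpret f: Vector_Spaces.linear s "(*)" f by fact
  have \<beta>: "bilinear_on V W (*) (\<lambda>v w. f (\<phi> v w))"
    using \<phi> by (auto simp: bilinear_on_def linear_on_def f.add f.scale)
  have f_sum: "f (\<Sum>(v, w)\<leftarrow>xs. \<phi> v w) = (\<Sum>(v, w)\<leftarrow>xs. f (\<phi> v w))" for xs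
    by (induction xs) (auto simp: f.add f.zero)
  have "f ?d = 0"
    using eq sum_pure_apply[OF \<beta>, of ps] sum_pure_apply[OF \<beta>, of qs]
    by (simp add: f.diff f_sum)
  with nz show False by simp
qed

lemma sweedler_sum_pure:
  assumes "vector_space s" "bilinear_on V W s \<phi>" "set ps \<subseteq> vcarrier V \<times> vcarrier W"
  shows "sweedler V W (\<Sum>(v, w)\<leftarrow>ps. pure V W v w) \<phi> = (\<Sum>(v, w)\<leftarrow>ps. \<phi> v w)"
proof -
  define t where "t = (\<Sum>(v, w)\<leftarrow>ps. pure V W v w)"
  define qs where "qs = (SOME ps. set ps \<subseteq> vcarrier V \<times> vcarrier W \<and> t = (\<Sum>(v, w)\<leftarrow>ps. pure V W v w))"
  have "set qs \<subseteq> vcarrier V \<times> vcarrier W \<and> t = (\<Sum>(v, w)\<leftarrow>qs. pure V W v w)"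
    unfolding qs_def by (rule someI[of _ ps]) (use assms t_def in auto)
  then have "(\<Sum>(v, w)\<leftarrow>qs. \<phi> v w) = (\<Sum>(v, w)\<leftarrow>ps. \<phi> v w)"
    using sum_pure_eq[OF assms(1,2)] t_def by metis
  then show ?thesis by (simp add: sweedler_def Let_def flip: t_def qs_def)
qed

lemma sweedler_pure:
  assumes "vector_space s" "bilinear_on V W s \<phi>" "v \<in> vcarrier V" "w \<in> vcarrier W"
  shows "sweedler V W (pure V W v w) \<phi> = \<phi> v w"
  using sweedler_sum_pure[OF assms(1,2), of "[(v, w)]"] assms(3,4) by simp

lemma sweedler_linear:
  assumes V: "vspace V" and s: "vector_space s" and \<phi>: "bilinear_on V W s \<phi>"
  shows "linear_on (V \<otimes>\<^sub>v W) s (\<lambda>t. sweedler V W t \<phi>)"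
proof -
  interpret V: vector_space "vscale V" using V by (simp add: vspace_def)
  interpret s: vector_space s by (rule s)
  interpret T: vector_space tscale by (rule vector_space_tscale)
  note sw = sweedler_sum_pure[OF s \<phi>]
  show ?thesis
    unfolding linear_on_def
  proof (intro conjI ballI allI)
    fix x y assume "x \<in> vcarrier (V \<otimes>\<^sub>v W)" "y \<in> vcarrier (V \<otimes>\<^sub>v W)"
    then obtain ps qs where *: "set ps \<subseteq> vcarrier V \<times> vcarrier W" "x = (\<Sum>(v, w)\<leftarrow>ps. pure V W v w)"
      "set qs \<subseteq> vcarrier V \<times> vcarrier W" "y = (\<Sum>(v, w)\<leftarrow>qs. pure V W v w)"
      using tensor_space_decomp[OF V, of x W] tensor_space_decomp[OF V, of y W] by blast
    then show "sweedler V W (x + y) \<phi> = sweedler V W x \<phi> + sweedler V W y \<phi>"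
      using sw[of "ps @ qs"] sw[of ps] sw[of qs] by simp
  next
    fix c x assume "x \<in> vcarrier (V \<otimes>\<^sub>v W)"
    then obtain ps where *: "set ps \<subseteq> vcarrier V \<times> vcarrier W" "x = (\<Sum>(v, w)\<leftarrow>ps. pure V W v w)"
      using tensor_space_decomp[OF V, of x W] by blast
    let ?qs = "map (\<lambda>(v, w). (vscale V c v, w)) ps"
    have sub: "set ?qs \<subseteq> vcarrier V \<times> vcarrier W"
      using *(1) V by (auto simp: vspace_def intro!: V.subspace_scale)
    have scale: "(\<Sum>(v, w)\<leftarrow>?qs. \<psi> v w) = r c (\<Sum>(v, w)\<leftarrow>ps. \<psi> v w)"
      if "vector_space r" "bilinear_on V W r \<psi>" for r and \<psi> :: "_ \<Rightarrow> _ \<Rightarrow> 'z::ab_group_add"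
    proof -
      interpret r: vector_space r by fact
      show ?thesis using *(1) that(2)
        by (induction ps) (auto simp: r.scale_right_distrib bilinear_on_def linear_on_def)
    qed
    have "tscale c x = (\<Sum>(v, w)\<leftarrow>?qs. pure V W v w)"
      unfolding *(2) by (rule scale[OF vector_space_tscale bilinear_on_pure, symmetric])
    then have "sweedler V W (tscale c x) \<phi> = s c (sweedler V W x \<phi>)"
      using sw[OF sub] sw[OF *(1)] scale[OF s \<phi>] *(2) by simp
    then show "sweedler V W (vscale (V \<otimes>\<^sub>v W) c x) \<phi> = s c (sweedler V W x \<phi>)"
      by (simp add: tensor_space_def)
  qed
qed


section \<open>Hopf algebras\<close>

text \<open>
  Unit and multiplication of the Hopf algebra are those of the \<^class>\<open>ring_1\<close> type \<open>'h\<close>.  The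
  condition \<open>0 \<noteq> 1\<close> built into this class follows from \<open>counit H 1 = 1\<close>.
\<close>

record ('k, 'h) hopf = "('k, 'h) vsp" +
  comult :: "'h \<Rightarrow> ('k, 'h, 'h) tensor"
  counit :: "'h \<Rightarrow> 'k"
  antipode :: "'h \<Rightarrow> 'h"

locale hopf_algebra =
  fixes H :: "('k::field, 'h::ring_1) hopf"
  assumes vcarrier_UNIV: "vcarrier H = UNIV"
    and vector_space: "vector_space (vscale H)"
    and scale_mult_left: "vscale H c a * b = vscale H c (a * b)"
    and scale_mult_right: "a * vscale H c b = vscale H c (a * b)"
    and comult_linear: "linear_on H tscale (comult H)"
    and comult_closed: "comult H a \<in> vcarrier (H \<otimes>\<^sub>v H)"
    and counit_linear: "linear_on H (*) (counit H)"
    and antipode_linear: "linear_on H (vscale H) (antipode H)"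
    and coassoc:
      "sweedler H H (comult H a) (\<lambda>a1 a2. sweedler H H (comult H a1)
         (\<lambda>x y. pure H (H \<otimes>\<^sub>v H) x (pure H H y a2)))
       = sweedler H H (comult H a) (\<lambda>a1 a2. pure H (H \<otimes>\<^sub>v H) a1 (comult H a2))"
    and counit_left: "sweedler H H (comult H a) (\<lambda>a1 a2. vscale H (counit H a1) a2) = a"
    and counit_right: "sweedler H H (comult H a) (\<lambda>a1 a2. vscale H (counit H a2) a1) = a"
    and comult_mult:
      "comult H (a * b) = sweedler H H (comult H a) (\<lambda>a1 a2.
         sweedler H H (comult H b) (\<lambda>b1 b2. pure H H (a1 * b1) (a2 * b2)))"
    and comult_one: "comult H 1 = pure H H 1 1"
    and counit_mult: "counit H (a * b) = counit H a * counit H b"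
    and counit_one: "counit H 1 = 1"
    and antipode_left:
      "sweedler H H (comult H a) (\<lambda>a1 a2. antipode H a1 * a2) = vscale H (counit H a) 1"
    and antipode_right:
      "sweedler H H (comult H a) (\<lambda>a1 a2. a1 * antipode H a2) = vscale H (counit H a) 1"

definition hopf_iso ::
  "('k::field, 'a::ring_1) hopf \<Rightarrow> ('k, 'b::ring_1) hopf \<Rightarrow> ('a \<Rightarrow> 'b) \<Rightarrow> bool" where
  "hopf_iso A B f \<longleftrightarrow>
     linear_on A (vscale B) f \<and> bij_betw f (vcarrier A) (vcarrier B) \<and>
     (\<forall>x y. f (x * y) = f x * f y) \<and> f 1 = 1 \<and>
     (\<forall>x. comult B (f x) = sweedler A A (comult A x) (\<lambda>x1 x2. pure B B (f x1) (f x2))) \<and>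
     (\<forall>x. counit B (f x) = counit A x) \<and>
     (\<forall>x. antipode B (f x) = f (antipode A x))"

definition base_field :: "('k::field, 'k) vsp" where
  "base_field = \<lparr>vscale = (*), vcarrier = UNIV\<rparr>"

definition trivial_hopf :: "('k::field, 'k) hopf" where
  "trivial_hopf =
     \<lparr>vscale = (*), vcarrier = UNIV,
      comult = (\<lambda>c. tscale c (pure base_field base_field 1 1)),
      counit = (\<lambda>c. c), antipode = (\<lambda>c. c)\<rparr>"

lemma hopf_algebra_trivial_hopf: "hopf_algebra (trivial_hopf :: ('k::field, 'k) hopf)"
proof -
  let ?k = "trivial_hopf :: ('k, 'k) hopf"
  have sel: "vscale ?k = (*)" "vcarrier ?k = UNIV" "counit ?k = (\<lambda>c. c)" "antipode ?k = (\<lambda>c. c)"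
    by (simp_all add: trivial_hopf_def)
  have bil: "bilinear_on base_field base_field (*) = bilinear_on ?k ?k ((*) :: 'k \<Rightarrow> 'k \<Rightarrow> 'k)"
    by (simp add: fun_eq_iff bilinear_on_def linear_on_def base_field_def sel)
  define u where "u = pure ?k ?k 1 1"
  have pure_u: "pure ?k ?k a b = tscale (a * b) u" for a b
  proof -
    have "pure ?k ?k (a * 1) (b * 1) = tscale b (tscale a u)"
      using bilinear_on_pure[of ?k ?k] unfolding bilinear_on_def linear_on_def sel u_def
      by (simp only: UNIV_I ball_UNIV)
    then show ?thesis by (simp add: tscale_def ac_simps)
  qed
  have "pure base_field base_field (1::'k) 1 = u"
    by (simp add: pure_def bil u_def)
  then have comult: "comult ?k c = tscale c u" for c
    by (simp add: trivial_hopf_def)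
  have u: "tscale c u \<in> vcarrier (?k \<otimes>\<^sub>v ?k)" for c
    using pure_in_tensor_space[of 1 ?k c ?k] by (simp add: sel pure_u)
  have tscale: "vscale (?k \<otimes>\<^sub>v ?k) = tscale" by (simp add: tensor_space_def)
  define z where "z = pure ?k (?k \<otimes>\<^sub>v ?k) 1 u"
  have pure_z: "pure ?k (?k \<otimes>\<^sub>v ?k) a (tscale b u) = tscale (a * b) z" for a b
  proof -
    have B: "bilinear_on ?k (?k \<otimes>\<^sub>v ?k) tscale (pure ?k (?k \<otimes>\<^sub>v ?k))"
      by (rule bilinear_on_pure)
    have "u \<in> vcarrier (?k \<otimes>\<^sub>v ?k)" using u[of 1] by (simp add: tscale_def)
    then have "pure ?k (?k \<otimes>\<^sub>v ?k) (a * 1) (tscale b u) = tscale b (tscale a z)"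
      using B u[of b] unfolding bilinear_on_def linear_on_def sel z_def tscale
      by (simp only: UNIV_I ball_UNIV)
    then show ?thesis by (simp add: tscale_def ac_simps)
  qed
  have sw: "sweedler ?k ?k (tscale c u) \<phi> = \<phi> c 1"
    if "vector_space s" "bilinear_on ?k ?k s \<phi>" for s c and \<phi> :: "'k \<Rightarrow> 'k \<Rightarrow> 'c::ab_group_add"
    using sweedler_pure[OF that, of c 1] by (simp add: sel pure_u)
  have sw_k: "sweedler ?k ?k (tscale c u) (\<lambda>x y. d * (x * y)) = d * c"
      "sweedler ?k ?k (tscale c u) (\<lambda>x y. x * y) = c" for c d
    by (subst sw[OF vector_space_times];
        simp add: bilinear_on_def linear_on_def sel algebra_simps)+
  have sw_t: "sweedler ?k ?k (tscale c u) (\<lambda>x y. tscale (d * (x * y)) w) = tscale (d * c) w"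
    for c d and w :: "'i \<Rightarrow> 'k"
    by (subst sw[OF vector_space_tscale];
        simp add: bilinear_on_def linear_on_def sel tscale_def fun_eq_iff algebra_simps)
  have sw_t1: "sweedler ?k ?k (tscale c u) (\<lambda>x y. tscale (x * y) w) = tscale c w"
    for c and w :: "'i \<Rightarrow> 'k"
    using sw_t[of c 1 w] by simp
  have comm: "(\<lambda>x y. y * x) = (\<lambda>x y. x * (y::'k))"
    by (simp add: mult.commute)
  have mult: "sweedler ?k ?k (tscale a u) (\<lambda>a1 a2. sweedler ?k ?k (tscale b u)
         (\<lambda>b1 b2. tscale (a1 * b1 * (a2 * b2)) u)) = tscale (a * b) u" for a b
  proof -
    have "(\<lambda>b1 b2. tscale (a1 * b1 * (a2 * b2)) u) = (\<lambda>b1 b2. tscale (a1 * a2 * (b1 * b2)) u)" for a1 a2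
      by (simp add: ac_simps)
    then have "sweedler ?k ?k (tscale b u) (\<lambda>b1 b2. tscale (a1 * b1 * (a2 * b2)) u)
        = tscale (b * (a1 * a2)) u" for a1 a2
      by (simp only: sw_t) (simp add: ac_simps)
    then show ?thesis by (simp only: sw_t) (simp add: ac_simps)
  qed
  have coassoc: "sweedler ?k ?k (tscale a u) (\<lambda>a1 a2. sweedler ?k ?k (tscale a1 u)
         (\<lambda>x y. tscale (x * (y * a2)) z)) = tscale a z" for a
  proof -
    have "(\<lambda>x y. tscale (x * (y * a2)) z) = (\<lambda>x y. tscale (a2 * (x * y)) z)" for a2
      by (simp add: ac_simps)
    then have "sweedler ?k ?k (tscale a1 u) (\<lambda>x y. tscale (x * (y * a2)) z) = tscale (a1 * a2) z"
      for a1 a2 by (simp only: sw_t) (simp add: ac_simps)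
    then show ?thesis by (simp only: sw_t1)
  qed
  show ?thesis
    by unfold_locales
      (simp_all only: sel comult pure_u pure_z sw_k sw_t1 comm mult coassoc u vector_space_times,
       simp_all add: comult linear_on_def sel tscale_def fun_eq_iff algebra_simps)
qed


section \<open>Yetter-Drinfel'd-Long bimodules\<close>

text \<open>
  An object consists of a vector space M with actions \<open>h \<triangleright> m = lact M h m\<close>, \<open>m \<triangleleft> h = ract M m h\<close>
  and coactions \<open>lcoact M m = m\<^sub>[\<^sub>-\<^sub>1\<^sub>] \<otimes> m\<^sub>[\<^sub>0\<^sub>]\<close>, \<open>rcoact M m = m\<^sub>(\<^sub>0\<^sub>) \<otimes> m\<^sub>(\<^sub>1\<^sub>)\<close>.  The values of these maps
  at elements outside of \<^term>\<open>vcarrier M\<close> are irrelevant.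

  Since HOL does not quantify over types, the category over H is taken relative to a universe, an
  abelian group type \<open>'m\<close> whose subgroups carry the objects.  It is meaningful only if \<open>'m\<close> is large
  enough to contain a linear copy of H.
\<close>

record ('k, 'h, 'm) bimod = "('k, 'm) vsp" +
  lact :: "'h \<Rightarrow> 'm \<Rightarrow> 'm"
  ract :: "'m \<Rightarrow> 'h \<Rightarrow> 'm"
  lcoact :: "'m \<Rightarrow> ('k, 'h, 'm) tensor"
  rcoact :: "'m \<Rightarrow> ('k, 'm, 'h) tensor"

definition is_bimodule ::
  "('k::field, 'h::ring_1) hopf \<Rightarrow> ('k, 'h, 'm::ab_group_add) bimod \<Rightarrow> bool" where
  "is_bimodule H M \<longleftrightarrow>
     bilinear_on H M (vscale M) (lact M) \<and> bilinear_on M H (vscale M) (ract M) \<and>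
     (\<forall>m \<in> vcarrier M. \<forall>a b.
        lact M a m \<in> vcarrier M \<and> ract M m a \<in> vcarrier M \<and>
        lact M 1 m = m \<and> lact M (a * b) m = lact M a (lact M b m) \<and>
        ract M m 1 = m \<and> ract M m (a * b) = ract M (ract M m a) b \<and>
        ract M (lact M a m) b = lact M a (ract M m b))"

definition is_bicomodule ::
  "('k::field, 'h::ring_1) hopf \<Rightarrow> ('k, 'h, 'm::ab_group_add) bimod \<Rightarrow> bool" where
  "is_bicomodule H M \<longleftrightarrow>
     linear_on M tscale (lcoact M) \<and> linear_on M tscale (rcoact M) \<and>
     (\<forall>m \<in> vcarrier M.
        lcoact M m \<in> vcarrier (H \<otimes>\<^sub>v M) \<and> rcoact M m \<in> vcarrier (M \<otimes>\<^sub>v H) \<and>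
        sweedler H M (lcoact M m) (\<lambda>a n. vscale M (counit H a) n) = m \<and>
        sweedler M H (rcoact M m) (\<lambda>n a. vscale M (counit H a) n) = m \<and>
        sweedler H M (lcoact M m) (\<lambda>a n. sweedler H H (comult H a)
          (\<lambda>a1 a2. pure H (H \<otimes>\<^sub>v M) a1 (pure H M a2 n)))
        = sweedler H M (lcoact M m) (\<lambda>a n. pure H (H \<otimes>\<^sub>v M) a (lcoact M n)) \<and>
        sweedler M H (rcoact M m) (\<lambda>n b. sweedler M H (rcoact M n)
          (\<lambda>p a. pure M (H \<otimes>\<^sub>v H) p (pure H H a b)))
        = sweedler M H (rcoact M m) (\<lambda>n a. pure M (H \<otimes>\<^sub>v H) n (comult H a)) \<and>
        sweedler H M (lcoact M m) (\<lambda>a n. pure H (M \<otimes>\<^sub>v H) a (rcoact M n))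
        = sweedler M H (rcoact M m) (\<lambda>n b. sweedler H M (lcoact M n)
            (\<lambda>a p. pure H (M \<otimes>\<^sub>v H) a (pure M H p b))))"

definition yetter_drinfeld_long ::
  "('k::field, 'h::ring_1) hopf \<Rightarrow> ('k, 'h, 'm::ab_group_add) bimod \<Rightarrow> bool" where
  "yetter_drinfeld_long H M \<longleftrightarrow>
     vspace M \<and> is_bimodule H M \<and> is_bicomodule H M \<and>
     (\<forall>h. \<forall>m \<in> vcarrier M.
        sweedler H H (comult H h) (\<lambda>h1 h2.
          sweedler H M (lcoact M (lact M h1 m)) (\<lambda>a n. pure H M (a * h2) n))
        = sweedler H H (comult H h) (\<lambda>h1 h2.
            sweedler H M (lcoact M m) (\<lambda>a n. pure H M (h1 * a) (lact M h2 n))) \<and>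
        rcoact M (lact M h m) = sweedler M H (rcoact M m) (\<lambda>n a. pure M H (lact M h n) a) \<and>
        sweedler H H (comult H h) (\<lambda>h1 h2.
          sweedler M H (rcoact M (ract M m h2)) (\<lambda>n a. pure M H n (h1 * a)))
        = sweedler H H (comult H h) (\<lambda>h1 h2.
            sweedler M H (rcoact M m) (\<lambda>n a. pure M H (ract M n h1) (a * h2))) \<and>
        lcoact M (ract M m h) = sweedler H M (lcoact M m) (\<lambda>a n. pure H M a (ract M n h)))"

definition braiding ::
  "('k::field, 'h::ring_1) hopf \<Rightarrow> ('k, 'h, 'm::ab_group_add) bimod \<Rightarrow>
   ('k, 'h, 'n::ab_group_add) bimod \<Rightarrow> ('k, 'm, 'n) tensor \<Rightarrow> ('k, 'n, 'm) tensor" where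
  "braiding H M N t =
     sweedler M N t (\<lambda>m n.
       sweedler H M (lcoact M m) (\<lambda>a m0.
         sweedler N H (rcoact N n) (\<lambda>n0 b. pure N M (lact N a n0) (ract M m0 b))))"

end

theory Submission
  imports Defs
begin

text \<open>
  A left Yetter-Drinfel'd module, with the trivial right action and the trivial right coaction, is a
  Yetter-Drinfel'd-Long bimodule, and on such objects \<open>\<psi>\<close> is the usual braiding
  \<open>m \<otimes> n \<mapsto> m\<^sub>[\<^sub>-\<^sub>1\<^sub>] \<triangleright> n \<otimes> m\<^sub>[\<^sub>0\<^sub>]\<close>.  Two such structures on the space H are enough: M is H with
  the adjoint action \<open>h \<triangleright> x = h\<^sub>1 x S(h\<^sub>2)\<close> and the comultiplication as coaction, and N is H with
  left multiplication as action and the coaction \<open>x \<mapsto> x\<^sub>1 S(x\<^sub>3) \<otimes> x\<^sub>2\<close>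
  (\<open>left_yetter_drinfeld_adjoint\<close>, \<open>left_yetter_drinfeld_regular\<close>).  Then

    \<open>\<psi>\<^sub>N\<^sub>M (\<psi>\<^sub>M\<^sub>N (x \<otimes> 1)) = \<psi>\<^sub>N\<^sub>M (x\<^sub>1 \<otimes> x\<^sub>2) = x\<^sub>1 S(x\<^sub>3) \<triangleright> x\<^sub>4 \<otimes> x\<^sub>2\<close>.

  The counit is a homomorphism from the adjoint module to the trivial one, so applying it to the first
  factor gives x.  If \<open>\<psi>\<close> is a symmetry, the same operation on \<open>x \<otimes> 1\<close> gives \<open>\<epsilon>(x) 1\<close>, so that
  \<open>x = \<epsilon>(x) 1\<close> for all x (\<open>symmetric_imp_scalar\<close>) and the counit is an isomorphism of H onto the base
  field (\<open>hopf_iso_counit\<close>).  Conversely, if \<open>x = \<epsilon>(x) 1\<close> for all x, then counitality makes all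
  coactions trivial, and every \<open>\<psi>\<close> is the flip (\<open>braiding_trivial\<close>).

  Both modules are defined on the space H itself, and \<open>embedded_left_yetter_drinfeld\<close> carries them along
  a linear injection of H into the universe of the category.
\<close>

section \<open>Sums in Sweedler notation\<close>

lemma sum_list_case_prod_additive:
  assumes "f 0 = 0" "\<And>x y. f (x + y) = f x + f y"
  shows "f (\<Sum>(v, w)\<leftarrow>ps. \<phi> v w) = (\<Sum>(v, w)\<leftarrow>ps. f (\<phi> v w))"
  by (induction ps) (auto simp: assms)

text \<open>
  \<^const>\<open>sweedler\<close> is a finite sum over some fixed list of pairs, whatever its last argument is.
  Additivity, evaluation of tensors at a form and interchange of two such sums therefore need no
  bilinearity.
\<close>

lemma sweedler_additive:
  assumes "f 0 = 0" "\<And>x y. f (x + y) = f x + f y"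
  shows "f (sweedler V W t \<phi>) = sweedler V W t (\<lambda>v w. f (\<phi> v w))"
  unfolding sweedler_def Let_def using assms by (rule sum_list_case_prod_additive)

lemma sweedler_apply: "sweedler V W t \<phi> \<beta> = sweedler V W t (\<lambda>v w. \<phi> v w \<beta>)"
  by (rule sweedler_additive[of "\<lambda>g. g \<beta>"]) simp_all

lemma sweedler_0:
  fixes V :: "('k::field, 'a::ab_group_add, 'x) vsp_scheme" and W :: "('k, 'b::ab_group_add, 'y) vsp_scheme"
  shows "sweedler V W t (\<lambda>v w. 0) = (0 :: 'c::ab_group_add)"
proof -
  have "(\<Sum>(v, w)\<leftarrow>ps. 0) = (0::'c)" for ps :: "('a \<times> 'b) list" by (induction ps) auto
  then show ?thesis by (simp only: sweedler_def Let_def)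
qed

lemma sweedler_add:
  "sweedler V W t (\<lambda>v w. \<phi> v w + \<psi> v w) = sweedler V W t \<phi> + sweedler V W t \<psi>"
proof -
  have "(\<Sum>(v, w)\<leftarrow>ps. \<phi> v w + \<psi> v w) = (\<Sum>(v, w)\<leftarrow>ps. \<phi> v w) + (\<Sum>(v, w)\<leftarrow>ps. \<psi> v w)" for ps
    by (induction ps) (auto simp: algebra_simps)
  then show ?thesis by (simp add: sweedler_def Let_def)
qed

lemma sweedler_scale:
  assumes "vector_space s"
  shows "sweedler V W t (\<lambda>v w. s c (\<phi> v w)) = s c (sweedler V W t \<phi>)"
proof -
  interpret vector_space s by fact
  show ?thesis by (rule sweedler_additive[symmetric]) (simp_all add: scale_right_distrib)
qed

lemma sweedler_swap:
  "sweedler V W t (\<lambda>v w. sweedler V' W' t' (\<phi> v w)) =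
   sweedler V' W' t' (\<lambda>x y. sweedler V W t (\<lambda>v w. \<phi> v w x y))"
proof -
  have "(\<Sum>(v, w)\<leftarrow>ps. sweedler V' W' t' (\<phi> v w)) =
      sweedler V' W' t' (\<lambda>x y. \<Sum>(v, w)\<leftarrow>ps. \<phi> v w x y)" for ps
    by (induction ps) (auto simp: sweedler_0 sweedler_add)
  then show ?thesis by (simp add: sweedler_def[of V W] Let_def)
qed

lemma sweedler_cong:
  assumes V: "vspace V" and t: "t \<in> vcarrier (V \<otimes>\<^sub>v W)"
    and eq: "\<And>v w. v \<in> vcarrier V \<Longrightarrow> w \<in> vcarrier W \<Longrightarrow> \<phi> v w = \<psi> v w"
  shows "sweedler V W t \<phi> = sweedler V W t \<psi>"
proof -
  let ?P = "\<lambda>ps. set ps \<subseteq> vcarrier V \<times> vcarrier W \<and> t = (\<Sum>(v, w)\<leftarrow>ps. pure V W v w)"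
  have "?P (SOME ps. ?P ps)" by (rule someI_ex) (rule tensor_space_decomp[OF V t])
  then have "map (case_prod \<phi>) (SOME ps. ?P ps) = map (case_prod \<psi>) (SOME ps. ?P ps)"
    using eq by (intro map_cong) auto
  then show ?thesis by (simp only: sweedler_def Let_def)
qed

lemma vscale_tensor_space [simp]: "vscale (V \<otimes>\<^sub>v W) = tscale"
  by (simp add: tensor_space_def)

lemma linear_on_sum_list:
  assumes V: "vspace V" and f: "linear_on V s f"
    and \<theta>: "\<And>a b. (a, b) \<in> set ps \<Longrightarrow> \<theta> a b \<in> vcarrier V"
  shows "(\<Sum>(a, b)\<leftarrow>ps. \<theta> a b) \<in> vcarrier V \<and>
    f (\<Sum>(a, b)\<leftarrow>ps. \<theta> a b) = (\<Sum>(a, b)\<leftarrow>ps. f (\<theta> a b))"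
proof -
  interpret V: vector_space "vscale V" using V by (simp add: vspace_def)
  have sub: "V.subspace (vcarrier V)" using V by (simp add: vspace_def)
  have add: "f (x + y) = f x + f y" if "x \<in> vcarrier V" "y \<in> vcarrier V" for x y
    using f that by (auto simp: linear_on_def)
  have "f (0 + 0) = f 0 + f 0"
    by (intro add V.subspace_0[OF sub])
  then have zero: "f 0 = 0" by simp
  show ?thesis
    using \<theta>
  proof (induction ps)
    case Nil
    show ?case
      using V.subspace_0[OF sub] zero by (simp only: list.map sum_list.Nil simp_thms)
  next
    case (Cons p ps)
    obtain a b where p: "p = (a, b)" by (cases p)
    have ab: "\<theta> a b \<in> vcarrier V" using Cons.prems p by simp
    have "(\<Sum>(a, b)\<leftarrow>ps. \<theta> a b) \<in> vcarrier V \<and>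
        f (\<Sum>(a, b)\<leftarrow>ps. \<theta> a b) = (\<Sum>(a, b)\<leftarrow>ps. f (\<theta> a b))"
      by (rule Cons.IH) (simp add: Cons.prems)
    then show ?case
      using ab by (simp only: p list.map sum_list.Cons prod.case add simp_thms V.subspace_add[OF sub])
  qed
qed

lemma linear_on_id: "linear_on V (vscale V) (\<lambda>x. x)"
  by (simp add: linear_on_def)

lemma sum_pure_in_tensor_space:
  assumes "set ps \<subseteq> vcarrier V \<times> vcarrier W"
  shows "(\<Sum>(v, w)\<leftarrow>ps. pure V W v w) \<in> vcarrier (V \<otimes>\<^sub>v W)"
  using assms
  by (intro linear_on_sum_list[OF vspace_tensor_space linear_on_id, THEN conjunct1] pure_in_tensor_space) auto

lemma sweedler_in_tensor_space:
  assumes "\<And>v w. \<theta> v w \<in> vcarrier (V \<otimes>\<^sub>v W)"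
  shows "sweedler A B t \<theta> \<in> vcarrier (V \<otimes>\<^sub>v W)"
  unfolding sweedler_def Let_def
  by (rule linear_on_sum_list[OF vspace_tensor_space linear_on_id, THEN conjunct1]) (rule assms)

lemma linear_on_sweedler:
  assumes "vspace V" "linear_on V s f" "\<And>a b. \<theta> a b \<in> vcarrier V"
  shows "f (sweedler A B t \<theta>) = sweedler A B t (\<lambda>a b. f (\<theta> a b))"
  unfolding sweedler_def Let_def
  by (rule linear_on_sum_list[OF assms(1,2), THEN conjunct2]) (rule assms(3))

lemma sweedler_sweedler:
  assumes "vspace V" "vector_space s" "bilinear_on V W s \<phi>"
    and "\<And>a b. \<theta> a b \<in> vcarrier (V \<otimes>\<^sub>v W)"
  shows "sweedler V W (sweedler A B t \<theta>) \<phi> = sweedler A B t (\<lambda>a b. sweedler V W (\<theta> a b) \<phi>)"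
  using vspace_tensor_space sweedler_linear[OF assms(1-3)] assms(4) by (rule linear_on_sweedler)

lemma linear_on_sweedler_arg:
  assumes V: "vspace V" and s: "vector_space s" and \<phi>: "bilinear_on V W s \<phi>"
    and t: "linear_on U tscale t" "\<And>x. x \<in> vcarrier U \<Longrightarrow> t x \<in> vcarrier (V \<otimes>\<^sub>v W)"
  shows "linear_on U s (\<lambda>x. sweedler V W (t x) \<phi>)"
  using sweedler_linear[OF V s \<phi>] t by (auto simp: linear_on_def)

lemma linear_on_sweedler_body:
  assumes s: "vector_space s" and \<phi>: "\<And>v w. linear_on U s (\<lambda>x. \<phi> x v w)"
  shows "linear_on U s (\<lambda>x. sweedler V W t (\<phi> x))"
proof -
  have "\<phi> (x + y) = (\<lambda>v w. \<phi> x v w + \<phi> y v w)" if "x \<in> vcarrier U" "y \<in> vcarrier U" for x y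
    using \<phi> that by (simp add: linear_on_def fun_eq_iff)
  moreover have "\<phi> (vscale U c x) = (\<lambda>v w. s c (\<phi> x v w))" if "x \<in> vcarrier U" for c x
    using \<phi> that by (simp add: linear_on_def fun_eq_iff)
  ultimately show ?thesis
    by (simp add: linear_on_def sweedler_add sweedler_scale[OF s])
qed

lemma linear_on_comp:
  assumes "linear_on V s f" "linear_on U (vscale V) g" "\<And>x. x \<in> vcarrier U \<Longrightarrow> g x \<in> vcarrier V"
  shows "linear_on U s (\<lambda>x. f (g x))"
  using assms by (simp add: linear_on_def)

lemma linear_on_pure_left:
  assumes "linear_on U (vscale V) f" "\<And>x. f x \<in> vcarrier V" "w \<in> vcarrier W"
  shows "linear_on U tscale (\<lambda>x. pure V W (f x) w)"
  using bilinear_on_pure[of V W] assms by (simp add: bilinear_on_def linear_on_def)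

lemma linear_on_pure_right:
  assumes "linear_on U (vscale W) f" "\<And>x. f x \<in> vcarrier W" "v \<in> vcarrier V"
  shows "linear_on U tscale (\<lambda>x. pure V W v (f x))"
  using bilinear_on_pure[of V W] assms by (simp add: bilinear_on_def linear_on_def)

text \<open>
  Identities between multilinear expressions with values in any vector space follow from those for
  scalar-valued forms, for which evaluation of tensors at forms is available.
\<close>

lemma eq_if_functionals_eq:
  assumes s: "vector_space (s :: 'k::field \<Rightarrow> 'a::ab_group_add \<Rightarrow> 'a)"
    and eq: "\<And>f. Vector_Spaces.linear s ((*) :: 'k \<Rightarrow> 'k \<Rightarrow> 'k) f \<Longrightarrow> f x = f y"
  shows "x = y"
proof (rule ccontr)
  assume "x \<noteq> y"
  then have "x - y \<noteq> 0" by simp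
  from functional_separates[OF s this] obtain f
    where f: "Vector_Spaces.linear s ((*) :: 'k \<Rightarrow> 'k \<Rightarrow> 'k) f" "f (x - y) \<noteq> 0" by blast
  interpret Vector_Spaces.linear s "(*)" f by (rule f(1))
  show False using f eq[OF f(1)] by (simp add: diff)
qed

lemma bilinear_on_cong:
  assumes "vspace V" "vspace W"
    and "\<And>v w. v \<in> vcarrier V \<Longrightarrow> w \<in> vcarrier W \<Longrightarrow> \<phi> v w = \<psi> v w"
  shows "bilinear_on V W s \<phi> \<longleftrightarrow> bilinear_on V W s \<psi>"
proof -
  interpret V: vector_space "vscale V" using assms(1) by (simp add: vspace_def)
  interpret W: vector_space "vscale W" using assms(2) by (simp add: vspace_def)
  have "V.subspace (vcarrier V)" "W.subspace (vcarrier W)"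
    using assms(1,2) by (simp_all add: vspace_def)
  then show ?thesis
    using assms(3) by (simp add: bilinear_on_def linear_on_def V.subspace_add V.subspace_scale
      W.subspace_add W.subspace_scale)
qed

section \<open>Sweedler calculus in a Hopf algebra\<close>

text \<open>
  The laws of a Hopf algebra are restated below for sums \<open>\<phi> a\<^sub>1 a\<^sub>2\<close> with \<open>\<phi>\<close> an arbitrary bilinear map,
  written \<open>sw a \<phi>\<close>.  Their side conditions say that an expression is linear in a variable that occurs
  in it once; the rules collected in \<open>lin\<close> decide these by following the syntax.
\<close>

context hopf_algebra
begin

abbreviation sw :: "'h \<Rightarrow> ('h \<Rightarrow> 'h \<Rightarrow> 'c::ab_group_add) \<Rightarrow> 'c" where
  "sw a \<phi> \<equiv> sweedler H H (comult H a) \<phi>"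

lemma UNIV_H [simp]: "x \<in> vcarrier H"
  by (simp add: vcarrier_UNIV)

lemma vspace_H: "vspace H"
proof -
  interpret vector_space "vscale H" by (rule vector_space)
  show ?thesis by (simp add: vspace_def vcarrier_UNIV vector_space subspace_UNIV)
qed

lemma bilinear_HI:
  "(\<And>y. linear_on H s (\<lambda>x. \<phi> x y)) \<Longrightarrow> (\<And>x. linear_on H s (\<lambda>y. \<phi> x y)) \<Longrightarrow> bilinear_on H H s \<phi>"
  by (simp add: bilinear_on_def)

lemmas vs = vector_space vector_space_times vector_space_tscale

lemma lin_mult_left: "linear_on H (vscale H) f \<Longrightarrow> linear_on H (vscale H) (\<lambda>x. f x * b)"
  by (simp add: linear_on_def scale_mult_left distrib_right)

lemma lin_mult_right: "linear_on H (vscale H) f \<Longrightarrow> linear_on H (vscale H) (\<lambda>x. b * f x)"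
  by (simp add: linear_on_def scale_mult_right distrib_left)

lemma lin_times_left: "linear_on H (*) f \<Longrightarrow> linear_on H (*) (\<lambda>x. f x * (b::'k))"
  by (simp add: linear_on_def algebra_simps)

lemma lin_times_right: "linear_on H (*) f \<Longrightarrow> linear_on H (*) (\<lambda>x. (b::'k) * f x)"
  by (simp add: linear_on_def algebra_simps)

lemma lin_antipode: "linear_on H (vscale H) f \<Longrightarrow> linear_on H (vscale H) (\<lambda>x. antipode H (f x))"
  using antipode_linear by (simp add: linear_on_def)

lemma lin_counit: "linear_on H (vscale H) f \<Longrightarrow> linear_on H (*) (\<lambda>x. counit H (f x))"
  using counit_linear by (simp add: linear_on_def)

lemma lin_scale_left:
  assumes "vector_space s" "linear_on H (*) f"
  shows "linear_on H s (\<lambda>x. s (f x) v)"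
proof -
  interpret vector_space s by fact
  show ?thesis using assms(2) by (simp add: linear_on_def scale_left_distrib)
qed

lemma lin_scale_right:
  assumes "vector_space s" "linear_on H s f"
  shows "linear_on H s (\<lambda>x. s c (f x))"
proof -
  interpret vector_space s by fact
  show ?thesis using assms(2) by (simp add: linear_on_def scale_right_distrib scale_left_commute)
qed

lemma lin_sw_arg:
  assumes "linear_on H (vscale H) f" "vector_space s"
    "\<And>y. linear_on H s (\<lambda>x. \<phi> x y)" "\<And>x. linear_on H s (\<lambda>y. \<phi> x y)"
  shows "linear_on H s (\<lambda>x. sw (f x) \<phi>)"
  using comult_linear assms(1)
  by (intro linear_on_sweedler_arg vspace_H assms bilinear_HI)
    (auto simp: linear_on_def comult_closed)

lemma lin_sw_body:
  assumes "vector_space s" "\<And>v w. linear_on H s (\<lambda>x. \<phi> x v w)"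
  shows "linear_on H s (\<lambda>x. sw b (\<phi> x))"
  using assms by (rule linear_on_sweedler_body)

lemmas lin = vs linear_on_id[of H] lin_mult_left lin_mult_right lin_times_left lin_times_right lin_antipode
  lin_counit lin_scale_left[OF vector_space] lin_scale_right[OF vector_space] lin_sw_arg lin_sw_body
  linear_on_pure_left linear_on_pure_right pure_in_tensor_space UNIV_H

lemma sw_functional:
  assumes "Vector_Spaces.linear s (*) f"
  shows "f (sweedler V W t \<phi>) = sweedler V W t (\<lambda>v w. f (\<phi> v w))"
proof -
  interpret f: Vector_Spaces.linear s "(*)" f by fact
  show ?thesis by (rule sweedler_additive) (simp_all add: f.zero f.add)
qed

lemma lin_functional:
  assumes "Vector_Spaces.linear s (*) f" "linear_on H s g"
  shows "linear_on H (*) (\<lambda>x. f (g x))"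
proof -
  interpret f: Vector_Spaces.linear s "(*)" f by fact
  show ?thesis using assms(2) by (simp add: linear_on_def f.add f.scale)
qed

lemma sw_coassoc_form:
  assumes T: "\<And>y z. linear_on H (*) (\<lambda>x. T x y z)" "\<And>x z. linear_on H (*) (\<lambda>y. T x y z)"
    "\<And>x y. linear_on H (*) (\<lambda>z. T x y z)"
  shows "sw a (\<lambda>a1 a2. sw a1 (\<lambda>x y. T x y a2)) = sw a (\<lambda>a1 a2. sw a2 (\<lambda>y z. T a1 y z))"
proof -
  let ?\<beta> = "\<lambda>x t. sweedler H H t (T x)"
  have "bilinear_on H (H \<otimes>\<^sub>v H) (*) ?\<beta>"
    unfolding bilinear_on_def
    by (intro conjI ballI sweedler_linear linear_on_sweedler_body vspace_H vs bilinear_HI T)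
  then have p: "pure H (H \<otimes>\<^sub>v H) x t ?\<beta> = ?\<beta> x t" for x t
    by (simp add: pure_def)
  have "?\<beta> x (pure H H y z) = T x y z" for x y z
    by (intro sweedler_pure[OF vector_space_times] bilinear_HI T UNIV_H)
  then show ?thesis
    using fun_cong[OF coassoc[of a], of ?\<beta>] by (simp add: sweedler_apply p)
qed

lemma sw_coassoc:
  assumes s: "vector_space s"
    and T: "\<And>y z. linear_on H s (\<lambda>x. T x y z)" "\<And>x z. linear_on H s (\<lambda>y. T x y z)"
    "\<And>x y. linear_on H s (\<lambda>z. T x y z)"
  shows "sw a (\<lambda>a1 a2. sw a1 (\<lambda>x y. T x y a2)) = sw a (\<lambda>a1 a2. sw a2 (\<lambda>y z. T a1 y z))"
proof (rule eq_if_functionals_eq[OF s])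
  fix f assume f: "Vector_Spaces.linear s ((*) :: 'k \<Rightarrow> 'k \<Rightarrow> 'k) f"
  show "f (sw a (\<lambda>a1 a2. sw a1 (\<lambda>x y. T x y a2))) = f (sw a (\<lambda>a1 a2. sw a2 (\<lambda>y z. T a1 y z)))"
    unfolding sw_functional[OF f] by (intro sw_coassoc_form lin_functional[OF f] T)
qed

lemma sw_mult:
  assumes s: "vector_space s"
    and \<phi>: "\<And>y. linear_on H s (\<lambda>x. \<phi> x y)" "\<And>x. linear_on H s (\<lambda>y. \<phi> x y)"
  shows "sw (a * b) \<phi> = sw a (\<lambda>a1 a2. sw b (\<lambda>b1 b2. \<phi> (a1 * b1) (a2 * b2)))"
proof -
  have "sw (a * b) \<phi> = sw a (\<lambda>a1 a2. sweedler H H (sw b (\<lambda>b1 b2. pure H H (a1 * b1) (a2 * b2))) \<phi>)"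
    unfolding comult_mult
    by (intro sweedler_sweedler[OF vspace_H s] vspace_H s bilinear_HI \<phi> sweedler_in_tensor_space pure_in_tensor_space UNIV_H)
  also have "\<dots> = sw a (\<lambda>a1 a2. sw b (\<lambda>b1 b2. sweedler H H (pure H H (a1 * b1) (a2 * b2)) \<phi>))"
    by (subst sweedler_sweedler[OF vspace_H s bilinear_HI])
      (simp_all add: \<phi> pure_in_tensor_space)
  also have "\<dots> = sw a (\<lambda>a1 a2. sw b (\<lambda>b1 b2. \<phi> (a1 * b1) (a2 * b2)))"
    by (subst sweedler_pure[OF s bilinear_HI]) (simp_all add: \<phi>)
  finally show ?thesis .
qed

lemma sw_one:
  assumes "vector_space s" "\<And>y. linear_on H s (\<lambda>x. \<phi> x y)" "\<And>x. linear_on H s (\<lambda>y. \<phi> x y)"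
  shows "sw 1 \<phi> = \<phi> 1 1"
  unfolding comult_one by (intro sweedler_pure[OF assms(1)] bilinear_HI assms UNIV_H)

lemma linear_H_sweedler:
  "linear_on H s f \<Longrightarrow> f (sweedler V W t \<phi>) = sweedler V W t (\<lambda>v w. f (\<phi> v w))"
  by (rule linear_on_sweedler[OF vspace_H _ UNIV_H])

lemma sw_counit_left:
  assumes f: "linear_on H s f"
  shows "sw a (\<lambda>x y. s (counit H x) (f y)) = f a"
proof -
  have "f a = f (sw a (\<lambda>x y. vscale H (counit H x) y))" by (simp add: counit_left)
  also have "\<dots> = sw a (\<lambda>x y. s (counit H x) (f y))"
    using f by (simp add: linear_H_sweedler[OF f]) (simp add: linear_on_def)
  finally show ?thesis ..
qed

lemma sw_counit_right:
  assumes f: "linear_on H s f"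
  shows "sw a (\<lambda>x y. s (counit H y) (f x)) = f a"
proof -
  have "f a = f (sw a (\<lambda>x y. vscale H (counit H y) x))" by (simp add: counit_right)
  also have "\<dots> = sw a (\<lambda>x y. s (counit H y) (f x))"
    using f by (simp add: linear_H_sweedler[OF f]) (simp add: linear_on_def)
  finally show ?thesis ..
qed

lemma sw_antipode_left:
  assumes f: "linear_on H s f"
  shows "sw a (\<lambda>x y. f (antipode H x * y)) = s (counit H a) (f 1)"
proof -
  have "sw a (\<lambda>x y. f (antipode H x * y)) = f (vscale H (counit H a) 1)"
    by (simp add: linear_H_sweedler[OF f, symmetric] antipode_left)
  then show ?thesis using f by (simp add: linear_on_def)
qed

lemma sw_antipode_right:
  assumes f: "linear_on H s f"
  shows "sw a (\<lambda>x y. f (x * antipode H y)) = s (counit H a) (f 1)"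
proof -
  have "sw a (\<lambda>x y. f (x * antipode H y)) = f (vscale H (counit H a) 1)"
    by (simp add: linear_H_sweedler[OF f, symmetric] antipode_right)
  then show ?thesis using f by (simp add: linear_on_def)
qed

text \<open>\<open>a\<^sub>1 S(a\<^sub>2) \<otimes> a\<^sub>3 = 1 \<otimes> a\<close>.\<close>

lemma sw_antipode_right_front:
  assumes s: "vector_space s" and \<phi>: "\<And>y. linear_on H s (\<lambda>x. \<phi> x y)" "\<And>x. linear_on H s (\<lambda>y. \<phi> x y)"
  shows "sw a (\<lambda>x w. sw w (\<lambda>y z. \<phi> (x * antipode H y) z)) = \<phi> 1 a"
proof -
  have "sw a (\<lambda>x w. sw w (\<lambda>y z. \<phi> (x * antipode H y) z)) = sw a (\<lambda>w z. sw w (\<lambda>x y. \<phi> (x * antipode H y) z))"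
    by (rule sw_coassoc[symmetric, OF s])
     (intro lin linear_on_comp[OF \<phi>(1)] \<phi> UNIV_H)+
  also have "\<dots> = sw a (\<lambda>w z. s (counit H w) (\<phi> 1 z))"
    by (simp add: sw_antipode_right[OF \<phi>(1)])
  also have "\<dots> = \<phi> 1 a" by (rule sw_counit_left[OF \<phi>(2)])
  finally show ?thesis .
qed

lemma antipode_one: "antipode H 1 = 1"
proof -
  interpret vector_space "vscale H" by (rule vector_space)
  have "sw 1 (\<lambda>x y. antipode H x * y) = antipode H 1 * 1"
    by (rule sw_one[OF vector_space]) (intro lin)+
  then show ?thesis
    using antipode_left[of 1] by (simp add: counit_one)
qed

lemma counit_antipode: "counit H (antipode H a) = counit H a"
proof -
  have L: "linear_on H (*) (counit H)" by (rule counit_linear)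
  have "counit H a = sw a (\<lambda>x y. counit H (antipode H x * y))"
    by (simp add: sw_antipode_left[OF L] counit_one)
  also have "\<dots> = sw a (\<lambda>x y. counit H y * counit H (antipode H x))"
    by (simp add: counit_mult mult.commute)
  also have "\<dots> = counit H (antipode H a)"
    by (rule sw_counit_right) (intro lin)
  finally show ?thesis ..
qed

text \<open>
  In the convolution algebra of linear maps from \<open>H \<otimes> H\<close> to H, both \<open>a \<otimes> b \<mapsto> S(a b)\<close> and
  \<open>a \<otimes> b \<mapsto> S(b) S(a)\<close> are inverse to the multiplication.  The sum X is the product of the left inverse,
  the multiplication and the right inverse.
\<close>

lemma antipode_mult: "antipode H (a * b) = antipode H b * antipode H a"
proof -
  interpret vector_space "vscale H" by (rule vector_space)
  let ?S = "antipode H" and ?\<epsilon> = "counit H"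
  let ?X = "sw a (\<lambda>a1 a'. sw a' (\<lambda>a2 a3. sw b (\<lambda>b1 b'. sw b' (\<lambda>b2 b3.
    ?S (a1 * b1) * (a2 * b2) * (?S b3 * ?S a3)))))"
  have "?X = sw a (\<lambda>a1 a'. sw a' (\<lambda>a2 a3. sw b (\<lambda>b1 b'. sw b' (\<lambda>b2 b3.
    ?S (a1 * b1) * a2 * (b2 * ?S b3) * ?S a3))))"
    by (simp only: mult.assoc)
  also have "\<dots> = sw a (\<lambda>a1 a'. sw a' (\<lambda>a2 a3. sw b (\<lambda>b1 b'. vscale H (?\<epsilon> b') (?S (a1 * b1) * a2 * 1 * ?S a3))))"
    by (subst sw_antipode_right[where s = "vscale H"]) (intro lin refl)+
  also have "\<dots> = sw a (\<lambda>a1 a'. sw a' (\<lambda>a2 a3. ?S (a1 * b) * a2 * 1 * ?S a3))"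
    by (subst sw_counit_right[where s = "vscale H"]) (intro lin refl)+
  also have "\<dots> = sw a (\<lambda>a1 a'. sw a' (\<lambda>a2 a3. ?S (a1 * b) * (a2 * ?S a3)))"
    by (simp only: mult.assoc mult_1_left)
  also have "\<dots> = sw a (\<lambda>a1 a'. vscale H (?\<epsilon> a') (?S (a1 * b) * 1))"
    by (subst sw_antipode_right[where s = "vscale H"]) (intro lin refl)+
  also have "\<dots> = ?S (a * b) * 1"
    by (subst sw_counit_right[where s = "vscale H"]) (intro lin refl)+
  finally have 1: "?X = ?S (a * b)" by simp
  have "?X = sw a (\<lambda>w a3. sw w (\<lambda>a1 a2. sw b (\<lambda>b1 b'. sw b' (\<lambda>b2 b3.
      ?S (a1 * b1) * (a2 * b2) * (?S b3 * ?S a3)))))"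
    by (rule sw_coassoc[symmetric, OF vector_space]) (intro lin)+
  also have "\<dots> = sw a (\<lambda>w a3. sw w (\<lambda>a1 a2. sw b (\<lambda>w' b3. sw w' (\<lambda>b1 b2.
      ?S (a1 * b1) * (a2 * b2) * (?S b3 * ?S a3)))))"
    by (subst sw_coassoc[OF vector_space]) (intro lin refl)+
  also have "\<dots> = sw a (\<lambda>w a3. sw b (\<lambda>w' b3. sw w (\<lambda>a1 a2. sw w' (\<lambda>b1 b2.
      ?S (a1 * b1) * (a2 * b2) * (?S b3 * ?S a3)))))"
    by (subst sweedler_swap) (rule refl)
  also have "\<dots> = sw a (\<lambda>w a3. sw b (\<lambda>w' b3. sw (w * w') (\<lambda>p q. ?S p * q * (?S b3 * ?S a3))))"
    by (subst sw_mult[OF vector_space]) (intro lin refl)+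
  also have "\<dots> = sw a (\<lambda>w a3. sw b (\<lambda>w' b3. vscale H (?\<epsilon> (w * w')) (1 * (?S b3 * ?S a3))))"
    by (subst sw_antipode_left[where s = "vscale H"]) (intro lin refl)+
  also have "\<dots> = sw a (\<lambda>w a3. sw b (\<lambda>w' b3. vscale H (?\<epsilon> w') (vscale H (?\<epsilon> w) (?S b3 * ?S a3))))"
    by (simp add: counit_mult mult.commute)
  also have "\<dots> = sw a (\<lambda>w a3. vscale H (?\<epsilon> w) (?S b * ?S a3))"
    by (subst sw_counit_left[where s = "vscale H"]) (intro lin refl)+
  also have "\<dots> = ?S b * ?S a"
    by (subst sw_counit_left[where s = "vscale H"]) (intro lin refl)+
  finally show ?thesis using 1 by simp
qed

text \<open>
  The antipode reverses the comultiplication: \<open>\<Delta>(S(h)) = S(h\<^sub>2) \<otimes> S(h\<^sub>1)\<close>.  Both sides are convolution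
  inverses of \<open>\<Delta>\<close>, and the proof evaluates
  \<open>\<Delta>(S(h\<^sub>1)) \<Delta>(h\<^sub>2) (S(h\<^sub>4) \<otimes> S(h\<^sub>3))\<close> in two ways.
\<close>

lemma sw_antipode:
  assumes s: "vector_space s"
    and \<beta>: "\<And>y. linear_on H s (\<lambda>x. \<beta> x y)" "\<And>x. linear_on H s (\<lambda>y. \<beta> x y)"
  shows "sw (antipode H h) \<beta> = sw h (\<lambda>h1 h2. \<beta> (antipode H h2) (antipode H h1))"
proof -
  interpret vector_space s by (rule s)
  let ?S = "antipode H" and ?\<epsilon> = "counit H"
  note lin = lin s linear_on_comp[OF \<beta>(1) _ UNIV_H] linear_on_comp[OF \<beta>(2) _ UNIV_H]
  let ?G = "\<lambda>u v p q k. sw k (\<lambda>r t. \<beta> (u * (p * ?S t)) (v * (q * ?S r)))"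
  let ?Q = "\<lambda>h' u v. sw h' (\<lambda>w k. sw w (\<lambda>p q. ?G u v p q k))"
  \<comment> \<open>\<open>\<Delta>(h'\<^sub>1) (S(h'\<^sub>3) \<otimes> S(h'\<^sub>2)) = \<epsilon>(h') (1 \<otimes> 1)\<close>, multiplied from the left by \<open>u \<otimes> v\<close>\<close>
  have Q: "?Q h' u v = s (?\<epsilon> h') (\<beta> u v)" for h' u v
  proof -
    have "?Q h' u v = sw h' (\<lambda>p w. sw w (\<lambda>q k. ?G u v p q k))"
      by (rule sw_coassoc[OF s]) (intro lin)+
    also have "\<dots> = sw h' (\<lambda>p w. \<beta> (u * (p * ?S w)) (v * 1))"
      by (subst sw_antipode_right_front[OF s, where \<phi> = "\<lambda>x t. \<beta> (u * (_ * ?S t)) (v * x)"]) (intro lin refl)+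
    also have "\<dots> = s (?\<epsilon> h') (\<beta> (u * 1) (v * 1))"
      by (rule sw_antipode_right) (intro lin)
    finally show ?thesis by simp
  qed
  let ?R = "\<lambda>h1 w k. sw (?S h1) (\<lambda>u v. sw w (\<lambda>p q. ?G u v p q k))"
  let ?F = "\<lambda>k x. sw x (\<lambda>x y. sw k (\<lambda>r t. \<beta> (x * ?S t) (y * ?S r)))"
  \<comment> \<open>\<open>\<Delta>\<close> is multiplicative, which joins \<open>\<Delta>(S(h\<^sub>1))\<close> with \<open>\<Delta>(h\<^sub>2)\<close>\<close>
  have R: "?R h1 w k = ?F k (?S h1 * w)" for h1 w k
    by (subst sw_mult[OF s]) (intro lin refl | simp only: mult.assoc)+
  have "sw (?S h) \<beta> = sw h (\<lambda>h1 h'. s (?\<epsilon> h') (sw (?S h1) \<beta>))"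
    by (rule sw_counit_right[symmetric]) (intro lin \<beta>)
  also have "\<dots> = sw h (\<lambda>h1 h'. sw (?S h1) (\<lambda>u v. ?Q h' u v))"
    by (simp only: Q sweedler_scale[OF s])
  also have "\<dots> = sw h (\<lambda>h1 h'. sw h' (\<lambda>w k. ?R h1 w k))"
    by (subst sweedler_swap) (rule refl)
  also have "\<dots> = sw h (\<lambda>z k. sw z (\<lambda>h1 w. ?R h1 w k))"
    by (rule sw_coassoc[symmetric, OF s]) (intro lin)+
  also have "\<dots> = sw h (\<lambda>z k. sw z (\<lambda>h1 w. ?F k (?S h1 * w)))"
    by (simp only: R)
  also have "\<dots> = sw h (\<lambda>z k. s (?\<epsilon> z) (?F k 1))"
    by (subst sw_antipode_left[where s = s]) (intro lin refl)+
  also have "\<dots> = ?F h 1"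
    by (rule sw_counit_left) (intro lin)
  also have "\<dots> = sw h (\<lambda>h1 h2. \<beta> (1 * ?S h2) (1 * ?S h1))"
    by (rule sw_one[OF s]) (intro lin)+
  finally show ?thesis by simp
qed

end

section \<open>Left Yetter-Drinfel'd modules as Yetter-Drinfel'd-Long bimodules\<close>

text \<open>
  The Yetter-Drinfel'd-Long bimodule carried by the image of H under a linear injection j into another
  space: its left action and coaction are \<open>\<alpha>\<close> and \<open>\<delta>\<close>, transported along j; its right action and
  coaction are trivial.  The tensor product of H with the object depends only on the underlying vector
  space V, which is what the coactions refer to.
\<close>

definition left_object ::
  "('k::field, 'h::ring_1) hopf \<Rightarrow> ('k \<Rightarrow> 'u \<Rightarrow> 'u) \<Rightarrow> ('h \<Rightarrow> 'u::ab_group_add) \<Rightarrow>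
   ('h \<Rightarrow> 'h \<Rightarrow> 'h) \<Rightarrow> ('h \<Rightarrow> ('k, 'h, 'h) tensor) \<Rightarrow> ('k, 'h, 'u) bimod" where
  "left_object H s j \<alpha> \<delta> =
     (let V = \<lparr>vscale = s, vcarrier = range j\<rparr> in
      \<lparr>vscale = s, vcarrier = range j,
       lact = (\<lambda>h u. j (\<alpha> h (inv j u))),
       ract = (\<lambda>u h. s (counit H h) u),
       lcoact = (\<lambda>u. sweedler H H (\<delta> (inv j u)) (\<lambda>a y. pure H V a (j y))),
       rcoact = (\<lambda>u. pure V H u 1)\<rparr>)"

text \<open>
  A left Yetter-Drinfel'd module over H whose underlying vector space is H, with action \<open>\<alpha>\<close> and
  coaction \<open>\<delta>\<close>.  Coassociativity and the compatibility condition are equations between tensors; they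
  are required after evaluation at every trilinear or bilinear form, which determines a tensor.
\<close>

locale left_yetter_drinfeld = hopf_algebra H for H :: "('k::field, 'h::ring_1) hopf" +
  fixes \<alpha> :: "'h \<Rightarrow> 'h \<Rightarrow> 'h" and \<delta> :: "'h \<Rightarrow> ('k, 'h, 'h) tensor"
  assumes act_linear_left: "linear_on H (vscale H) (\<lambda>h. \<alpha> h x)"
    and act_linear_right: "linear_on H (vscale H) (\<lambda>x. \<alpha> h x)"
    and act_one: "\<alpha> 1 x = x"
    and act_mult: "\<alpha> (a * b) x = \<alpha> a (\<alpha> b x)"
    and coact_linear: "linear_on H tscale \<delta>"
    and coact_closed: "\<delta> x \<in> vcarrier (H \<otimes>\<^sub>v H)"
    and coact_counit: "sweedler H H (\<delta> x) (\<lambda>a y. vscale H (counit H a) y) = x"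
    and coact_coassoc_form:
      "(\<And>b n. linear_on H (*) (\<lambda>a. T a b n)) \<Longrightarrow> (\<And>a n. linear_on H (*) (\<lambda>b. T a b n)) \<Longrightarrow>
       (\<And>a b. linear_on H (*) (\<lambda>n. T a b n)) \<Longrightarrow>
       sweedler H H (\<delta> x) (\<lambda>a n. sweedler H H (comult H a) (\<lambda>a1 a2. T a1 a2 n)) =
       sweedler H H (\<delta> x) (\<lambda>a n. sweedler H H (\<delta> n) (\<lambda>b m. T a b m))"
    and compatible_form:
      "(\<And>n. linear_on H (*) (\<lambda>a. \<beta> a n)) \<Longrightarrow> (\<And>a. linear_on H (*) (\<lambda>n. \<beta> a n)) \<Longrightarrow>
       sweedler H H (comult H h) (\<lambda>h1 h2. sweedler H H (\<delta> (\<alpha> h1 x)) (\<lambda>a n. \<beta> (a * h2) n)) =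
       sweedler H H (comult H h) (\<lambda>h1 h2. sweedler H H (\<delta> x) (\<lambda>a n. \<beta> (h1 * a) (\<alpha> h2 n)))"
begin

abbreviation D :: "'h \<Rightarrow> ('h \<Rightarrow> 'h \<Rightarrow> 'c::ab_group_add) \<Rightarrow> 'c" where
  "D x \<phi> \<equiv> sweedler H H (\<delta> x) \<phi>"

lemma coact_coassoc:
  assumes s: "vector_space s"
    and T: "\<And>b n. linear_on H s (\<lambda>a. T a b n)" "\<And>a n. linear_on H s (\<lambda>b. T a b n)"
      "\<And>a b. linear_on H s (\<lambda>n. T a b n)"
  shows "D x (\<lambda>a n. sw a (\<lambda>a1 a2. T a1 a2 n)) = D x (\<lambda>a n. D n (\<lambda>b m. T a b m))"
proof (rule eq_if_functionals_eq[OF s])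
  fix f assume f: "Vector_Spaces.linear s ((*) :: 'k \<Rightarrow> 'k \<Rightarrow> 'k) f"
  show "f (D x (\<lambda>a n. sw a (\<lambda>a1 a2. T a1 a2 n))) = f (D x (\<lambda>a n. D n (\<lambda>b m. T a b m)))"
    unfolding sw_functional[OF f] by (intro coact_coassoc_form lin_functional[OF f] T)
qed

lemma compatible:
  assumes s: "vector_space s"
    and \<beta>: "\<And>n. linear_on H s (\<lambda>a. \<beta> a n)" "\<And>a. linear_on H s (\<lambda>n. \<beta> a n)"
  shows "sw h (\<lambda>h1 h2. D (\<alpha> h1 x) (\<lambda>a n. \<beta> (a * h2) n)) =
         sw h (\<lambda>h1 h2. D x (\<lambda>a n. \<beta> (h1 * a) (\<alpha> h2 n)))"
proof (rule eq_if_functionals_eq[OF s])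
  fix f assume f: "Vector_Spaces.linear s ((*) :: 'k \<Rightarrow> 'k \<Rightarrow> 'k) f"
  show "f (sw h (\<lambda>h1 h2. D (\<alpha> h1 x) (\<lambda>a n. \<beta> (a * h2) n))) =
         f (sw h (\<lambda>h1 h2. D x (\<lambda>a n. \<beta> (h1 * a) (\<alpha> h2 n))))"
    unfolding sw_functional[OF f] by (intro compatible_form lin_functional[OF f] \<beta>)
qed

lemma lin_coact:
  assumes "linear_on H (vscale H) f" "vector_space s"
    "\<And>y. linear_on H s (\<lambda>x. \<phi> x y)" "\<And>x. linear_on H s (\<lambda>y. \<phi> x y)"
  shows "linear_on H s (\<lambda>x. D (f x) \<phi>)"
  using coact_linear assms(1)
  by (intro linear_on_sweedler_arg vspace_H assms bilinear_HI)
    (auto simp: linear_on_def coact_closed)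

lemma lin_coact_body:
  assumes "vector_space s" "\<And>v w. linear_on H s (\<lambda>x. \<phi> x v w)"
  shows "linear_on H s (\<lambda>x. D b (\<phi> x))"
  using assms by (rule linear_on_sweedler_body)

lemma lin_act_left: "linear_on H (vscale H) f \<Longrightarrow> linear_on H (vscale H) (\<lambda>x. \<alpha> (f x) y)"
  by (rule linear_on_comp[OF act_linear_left _ UNIV_H])

lemma lin_act_right: "linear_on H (vscale H) f \<Longrightarrow> linear_on H (vscale H) (\<lambda>x. \<alpha> y (f x))"
  by (rule linear_on_comp[OF act_linear_right _ UNIV_H])

end

text \<open>
  A left Yetter-Drinfel'd module on H together with a linear injection of H into another vector space.
\<close>

locale embedded_left_yetter_drinfeld = left_yetter_drinfeld H \<alpha> \<delta>
  for H :: "('k::field, 'h::ring_1) hopf" and \<alpha> \<delta> +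
  fixes s :: "'k \<Rightarrow> 'u::ab_group_add \<Rightarrow> 'u" and j :: "'h \<Rightarrow> 'u"
  assumes j_linear: "Vector_Spaces.linear (vscale H) s j" and j_inj: "inj j"
begin

sublocale j: Vector_Spaces.linear "vscale H" s j by (rule j_linear)

abbreviation M :: "('k, 'h, 'u) bimod" where "M \<equiv> left_object H s j \<alpha> \<delta>"

lemma M_vscale [simp]: "vscale M = s" and M_vcarrier: "vcarrier M = range j"
  by (simp_all add: left_object_def Let_def)

lemma M_pure: "pure H \<lparr>vscale = s, vcarrier = range j\<rparr> = pure H M"
  "pure \<lparr>vscale = s, vcarrier = range j\<rparr> H = pure M H"
  by (simp_all add: pure_def fun_eq_iff bilinear_on_def linear_on_def M_vcarrier)

lemma M_lact: "lact M h (j x) = j (\<alpha> h x)"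
  by (simp add: left_object_def Let_def j_inj)

lemma M_ract: "ract M (j x) h = j (vscale H (counit H h) x)"
  by (simp add: left_object_def Let_def j.scale)

lemma M_lcoact: "lcoact M (j x) = D x (\<lambda>a y. pure H M a (j y))"
  unfolding M_pure[symmetric] by (simp add: left_object_def Let_def j_inj)

lemma M_rcoact: "rcoact M (j x) = pure M H (j x) 1"
  unfolding M_pure[symmetric] by (simp add: left_object_def Let_def)

lemma M_carrier_j: "j x \<in> vcarrier M" by (simp add: M_vcarrier)

lemma vspace_M: "vspace M"
  by (simp add: vspace_def M_vcarrier j.vs2.vector_space_axioms)
    (use j.vs1.subspace_UNIV j.subspace_image in blast)

lemma linear_MI: "linear_on H s' (\<lambda>x. f (j x)) \<Longrightarrow> linear_on M s' f"
  by (simp add: linear_on_def M_vcarrier vcarrier_UNIV j.add[symmetric] j.scale[symmetric])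

lemma lin_j: "linear_on H (vscale H) f \<Longrightarrow> linear_on H (vscale M) (\<lambda>x. j (f x))"
  by (simp add: linear_on_def j.add j.scale)

lemma lin_tensor: "linear_on H tscale f \<Longrightarrow> linear_on H (vscale (V \<otimes>\<^sub>v W)) f"
  by simp

lemmas linM = lin lin_coact lin_coact_body lin_act_left lin_act_right lin_j lin_tensor M_carrier_j

lemma bilinear_HMI:
  "(\<And>x. linear_on H s' (\<lambda>h. \<phi> h (j x))) \<Longrightarrow> (\<And>h. linear_on H s' (\<lambda>x. \<phi> h (j x))) \<Longrightarrow>
   bilinear_on H M s' \<phi>"
  by (auto simp: bilinear_on_def M_vcarrier intro: linear_MI)

lemma bilinear_MHI:
  "(\<And>h. linear_on H s' (\<lambda>x. \<phi> (j x) h)) \<Longrightarrow> (\<And>x. linear_on H s' (\<lambda>h. \<phi> (j x) h)) \<Longrightarrow>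
   bilinear_on M H s' \<phi>"
  by (auto simp: bilinear_on_def M_vcarrier intro: linear_MI)

lemma sweedler_lcoact:
  assumes s': "vector_space s'"
    and \<phi>: "\<And>x. linear_on H s' (\<lambda>h. \<phi> h (j x))" "\<And>h. linear_on H s' (\<lambda>x. \<phi> h (j x))"
  shows "sweedler H M (lcoact M (j x)) \<phi> = D x (\<lambda>a y. \<phi> a (j y))"
  unfolding M_lcoact
  by (subst sweedler_sweedler[OF vspace_H s' bilinear_HMI])
    (simp_all add: \<phi> pure_in_tensor_space M_carrier_j sweedler_pure[OF s' bilinear_HMI])

lemma sweedler_rcoact:
  assumes s': "vector_space s'"
    and \<phi>: "\<And>h. linear_on H s' (\<lambda>x. \<phi> (j x) h)" "\<And>x. linear_on H s' (\<lambda>h. \<phi> (j x) h)"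
  shows "sweedler M H (rcoact M (j x)) \<phi> = \<phi> (j x) 1"
  unfolding M_rcoact
  by (simp add: \<phi> M_carrier_j sweedler_pure[OF s' bilinear_MHI])

lemma pure_scale_M: "pure M H (j (vscale H c x)) w = tscale c (pure M H (j x) w)"
  "pure H M w (j (vscale H c x)) = tscale c (pure H M w (j x))"
  using bilinear_on_pure[of M H] bilinear_on_pure[of H M]
  by (simp_all add: bilinear_on_def linear_on_def M_vcarrier j.scale)

lemma lcoact_linear: "linear_on M tscale (lcoact M)"
  unfolding M_lcoact by (rule linear_MI) (unfold M_lcoact, intro linM)

lemma lcoact_closed: "lcoact M (j x) \<in> vcarrier (H \<otimes>\<^sub>v M)"
  unfolding M_lcoact by (intro sweedler_in_tensor_space linM)

lemma is_bimodule_M: "is_bimodule H M"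
  unfolding is_bimodule_def
proof (intro conjI)
  show "bilinear_on H M (vscale M) (lact M)"
    by (rule bilinear_HMI) ((unfold M_lact)?, intro linM)+
  show "bilinear_on M H (vscale M) (ract M)"
    by (rule bilinear_MHI) ((unfold M_ract)?, intro linM)+
qed (auto simp: M_vcarrier M_lact M_ract act_one act_mult counit_one counit_mult
  j.vs1.scale_one mult.commute
   linear_on_def[THEN iffD1, OF act_linear_right, THEN conjunct2, rule_format])

lemma is_bicomodule_M: "is_bicomodule H M"
  unfolding is_bicomodule_def M_vcarrier ball_simps(9)
proof (intro conjI allI ballI; (erule rangeE, hypsubst)?)
  show "linear_on M tscale (lcoact M)" by (rule lcoact_linear)
  show "linear_on M tscale (rcoact M)"
    by (rule linear_MI) (unfold M_rcoact, intro linM)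
  fix x
  show "lcoact M (j x) \<in> vcarrier (H \<otimes>\<^sub>v M)" by (rule lcoact_closed)
  show "rcoact M (j x) \<in> vcarrier (M \<otimes>\<^sub>v H)"
    unfolding M_rcoact by (intro linM)
  have sM: "vector_space (vscale M)" using vspace_M by (simp add: vspace_def)
  have "sweedler H M (lcoact M (j x)) (\<lambda>a n. vscale M (counit H a) n) =
      D x (\<lambda>a y. vscale M (counit H a) (j y))"
    by (rule sweedler_lcoact[OF sM]) (intro linM lin_scale_left lin_scale_right sM)+
  also have "\<dots> = D x (\<lambda>a y. j (vscale H (counit H a) y))" by (simp add: j.scale)
  also have "\<dots> = j (D x (\<lambda>a y. vscale H (counit H a) y))"
    by (rule linear_H_sweedler[OF lin_j[OF linear_on_id], symmetric])
  finally show "sweedler H M (lcoact M (j x)) (\<lambda>a n. vscale M (counit H a) n) = j x"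
    by (simp add: coact_counit)
  show "sweedler M H (rcoact M (j x)) (\<lambda>n a. vscale M (counit H a) n) = j x"
    by (subst sweedler_rcoact[OF sM])
      (intro linM lin_scale_left lin_scale_right sM | simp add: counit_one)+
  have pl: "pure H (H \<otimes>\<^sub>v M) a (lcoact M (j y)) = D y (\<lambda>b m. pure H (H \<otimes>\<^sub>v M) a (pure H M b (j m)))"
    for a y
    unfolding M_lcoact
    by (rule linear_on_sweedler[where s = tscale and V = "H \<otimes>\<^sub>v M"])
      (use bilinear_on_pure[of H "H \<otimes>\<^sub>v M"] in \<open>simp_all add: bilinear_on_def pure_in_tensor_space M_carrier_j vspace_tensor_space\<close>)
  have "sweedler H M (lcoact M (j x)) (\<lambda>a n. sw a (\<lambda>a1 a2. pure H (H \<otimes>\<^sub>v M) a1 (pure H M a2 n))) =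
     D x (\<lambda>a n. sw a (\<lambda>a1 a2. pure H (H \<otimes>\<^sub>v M) a1 (pure H M a2 (j n))))"
    by (rule sweedler_lcoact[OF vector_space_tscale]) (intro linM)+
  also have "\<dots> = D x (\<lambda>a n. D n (\<lambda>b m. pure H (H \<otimes>\<^sub>v M) a (pure H M b (j m))))"
    by (rule coact_coassoc[OF vector_space_tscale]) (intro linM)+
  also have "\<dots> = D x (\<lambda>a n. pure H (H \<otimes>\<^sub>v M) a (lcoact M (j n)))"
    by (simp only: pl)
  also have "\<dots> = sweedler H M (lcoact M (j x)) (\<lambda>a n. pure H (H \<otimes>\<^sub>v M) a (lcoact M n))"
    by (rule sweedler_lcoact[OF vector_space_tscale, symmetric]) ((unfold pl)?, intro linM)+
  finally show "sweedler H M (lcoact M (j x)) (\<lambda>a n. sw a (\<lambda>a1 a2. pure H (H \<otimes>\<^sub>v M) a1 (pure H M a2 n))) =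
    sweedler H M (lcoact M (j x)) (\<lambda>a n. pure H (H \<otimes>\<^sub>v M) a (lcoact M n))" .
  have r: "sweedler M H (rcoact M (j x)) (\<lambda>p a. pure M (H \<otimes>\<^sub>v H) p (pure H H a b)) =
      pure M (H \<otimes>\<^sub>v H) (j x) (pure H H 1 b)" for x b
    by (rule sweedler_rcoact[OF vector_space_tscale]) (intro linM)+
  have "sweedler M H (rcoact M (j x)) (\<lambda>n b. sweedler M H (rcoact M n)
          (\<lambda>p a. pure M (H \<otimes>\<^sub>v H) p (pure H H a b))) = pure M (H \<otimes>\<^sub>v H) (j x) (pure H H 1 1)"
    by (subst sweedler_rcoact[OF vector_space_tscale]) ((unfold r)?, intro linM refl)+
  also have "\<dots> = sweedler M H (rcoact M (j x)) (\<lambda>n a. pure M (H \<otimes>\<^sub>v H) n (comult H a))"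
    using comult_linear
    by (subst sweedler_rcoact[OF vector_space_tscale]) (intro linM comult_closed | simp add: comult_one)+
  finally show "sweedler M H (rcoact M (j x)) (\<lambda>n b. sweedler M H (rcoact M n)
          (\<lambda>p a. pure M (H \<otimes>\<^sub>v H) p (pure H H a b)))
      = sweedler M H (rcoact M (j x)) (\<lambda>n a. pure M (H \<otimes>\<^sub>v H) n (comult H a))" .
  have l: "sweedler H M (lcoact M (j x)) (\<lambda>a p. pure H (M \<otimes>\<^sub>v H) a (pure M H p b)) =
      D x (\<lambda>a y. pure H (M \<otimes>\<^sub>v H) a (pure M H (j y) b))" for x b
    by (rule sweedler_lcoact[OF vector_space_tscale]) (intro linM)+
  have "sweedler H M (lcoact M (j x)) (\<lambda>a n. pure H (M \<otimes>\<^sub>v H) a (rcoact M n)) =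
      D x (\<lambda>a y. pure H (M \<otimes>\<^sub>v H) a (pure M H (j y) 1))"
    by (subst sweedler_lcoact[OF vector_space_tscale]) ((unfold M_rcoact)?, intro linM refl)+
  also have "\<dots> = sweedler M H (rcoact M (j x)) (\<lambda>n b. sweedler H M (lcoact M n)
            (\<lambda>a p. pure H (M \<otimes>\<^sub>v H) a (pure M H p b)))"
    by (subst sweedler_rcoact[OF vector_space_tscale]) ((unfold l)?, intro linM refl)+
  finally show "sweedler H M (lcoact M (j x)) (\<lambda>a n. pure H (M \<otimes>\<^sub>v H) a (rcoact M n)) =
     sweedler M H (rcoact M (j x)) (\<lambda>n b. sweedler H M (lcoact M n)
            (\<lambda>a p. pure H (M \<otimes>\<^sub>v H) a (pure M H p b)))" .
qed

lemma yetter_drinfeld_long_M: "yetter_drinfeld_long H M"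
  unfolding yetter_drinfeld_long_def
proof (intro conjI allI ballI vspace_M is_bimodule_M is_bicomodule_M)
  fix h m assume "m \<in> vcarrier M"
  then obtain x where m: "m = j x" by (auto simp: M_vcarrier)
  note vt = vector_space_tscale
  have 1: "sweedler H M (lcoact M (j x)) (\<lambda>a n. pure H M (a * k) n) = D x (\<lambda>a y. pure H M (a * k) (j y))" for x k
    by (rule sweedler_lcoact[OF vt]) (intro linM)+
  have 2: "sweedler H M (lcoact M (j x)) (\<lambda>a n. pure H M (k * a) (lact M k' n)) =
      D x (\<lambda>a y. pure H M (k * a) (j (\<alpha> k' y)))" for x k k'
    by (subst sweedler_lcoact[OF vt]) ((unfold M_lact)?, intro linM refl)+
  show "sw h (\<lambda>h1 h2. sweedler H M (lcoact M (lact M h1 m)) (\<lambda>a n. pure H M (a * h2) n)) =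
     sw h (\<lambda>h1 h2. sweedler H M (lcoact M m) (\<lambda>a n. pure H M (h1 * a) (lact M h2 n)))"
    unfolding m M_lact 1 2 by (rule compatible[OF vt]) (intro linM)+
  show "rcoact M (lact M h m) = sweedler M H (rcoact M m) (\<lambda>n a. pure M H (lact M h n) a)"
    unfolding m by (subst sweedler_rcoact[OF vt]) ((unfold M_lact M_rcoact)?, intro linM refl)+
  have 3: "sweedler M H (rcoact M (j x)) (\<lambda>n a. pure M H n (k * a)) = pure M H (j x) (k * 1)" for x k
    by (rule sweedler_rcoact[OF vt]) (intro linM)+
  have 4: "sweedler M H (rcoact M (j x)) (\<lambda>n a. pure M H (ract M n k) (a * k')) =
      pure M H (j (vscale H (counit H k) x)) (1 * k')" for x k k'
    by (subst sweedler_rcoact[OF vt]) ((unfold M_ract)?, intro linM refl)+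
  have "sw h (\<lambda>h1 h2. tscale (counit H h2) (pure M H (j x) h1)) = pure M H (j x) h"
    by (rule sw_counit_right) (intro linM)
  moreover have "sw h (\<lambda>h1 h2. tscale (counit H h1) (pure M H (j x) h2)) = pure M H (j x) h"
    by (rule sw_counit_left) (intro linM)
  ultimately show "sw h (\<lambda>h1 h2. sweedler M H (rcoact M (ract M m h2)) (\<lambda>n a. pure M H n (h1 * a))) =
     sw h (\<lambda>h1 h2. sweedler M H (rcoact M m) (\<lambda>n a. pure M H (ract M n h1) (a * h2)))"
    unfolding m 4 unfolding M_ract 3 by (simp add: pure_scale_M)
  have "sweedler H M (lcoact M (j x)) (\<lambda>a n. pure H M a (ract M n h)) =
      D x (\<lambda>a y. pure H M a (j (vscale H (counit H h) y)))"
    by (subst sweedler_lcoact[OF vt]) ((unfold M_ract)?, intro linM refl)+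
  also have "\<dots> = tscale (counit H h) (lcoact M (j x))"
    by (simp add: pure_scale_M sweedler_scale[OF vt] M_lcoact)
  also have "\<dots> = lcoact M (ract M (j x) h)"
    using lcoact_linear by (simp add: linear_on_def M_vcarrier M_ract j.scale)
  finally show "lcoact M (ract M m h) = sweedler H M (lcoact M m) (\<lambda>a n. pure H M a (ract M n h))"
    unfolding m ..
qed

end


section \<open>The adjoint and the regular module\<close>

context hopf_algebra
begin

text \<open>The left adjoint action \<open>h \<triangleright> x = h\<^sub>1 x S(h\<^sub>2)\<close>.\<close>

definition adjoint_act :: "'h \<Rightarrow> 'h \<Rightarrow> 'h" where
  "adjoint_act h x = sw h (\<lambda>a b. a * x * antipode H b)"

text \<open>The left coadjoint coaction \<open>x \<mapsto> x\<^sub>1 S(x\<^sub>3) \<otimes> x\<^sub>2\<close>.\<close>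

definition coadjoint_coact :: "'h \<Rightarrow> ('k, 'h, 'h) tensor" where
  "coadjoint_coact x = sw x (\<lambda>x1 y. sw y (\<lambda>x2 x3. pure H H (x1 * antipode H x3) x2))"

lemma counit_adjoint_act: "counit H (adjoint_act h x) = counit H h * counit H x"
proof -
  have "counit H (adjoint_act h x) = sw h (\<lambda>a b. counit H (a * x * antipode H b))"
    unfolding adjoint_act_def by (rule linear_H_sweedler[OF counit_linear])
  also have "\<dots> = sw h (\<lambda>a b. counit H a * (counit H b * counit H x))"
    by (simp add: counit_mult counit_antipode mult_ac)
  also have "\<dots> = counit H h * counit H x"
    by (rule sw_counit_left) (intro lin)
  finally show ?thesis .
qed

lemma left_yetter_drinfeld_adjoint: "left_yetter_drinfeld H adjoint_act (comult H)"
proof (unfold_locales)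
  fix x a b h
  show "linear_on H (vscale H) (\<lambda>h. adjoint_act h x)" "linear_on H (vscale H) (adjoint_act h)"
    unfolding adjoint_act_def by (intro lin)+
  show "adjoint_act 1 x = x"
    unfolding adjoint_act_def by (subst sw_one[OF vector_space]) (intro lin | simp add: antipode_one)+
  have push: "a1 * sw b \<phi> * a2 = sw b (\<lambda>b1 b2. a1 * \<phi> b1 b2 * a2)" for a1 a2 :: 'h and \<phi>
    by (rule sweedler_additive) (simp_all add: algebra_simps)
  show "adjoint_act (a * b) x = adjoint_act a (adjoint_act b x)"
    unfolding adjoint_act_def push
    by (subst sw_mult[OF vector_space]) (intro lin | simp add: antipode_mult mult.assoc)+
  show "linear_on H tscale (comult H)" by (rule comult_linear)
  show "comult H x \<in> vcarrier (H \<otimes>\<^sub>v H)" by (rule comult_closed)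
  show "sw x (\<lambda>a. vscale H (counit H a)) = x" by (rule counit_left)
next
  fix T :: "'h \<Rightarrow> 'h \<Rightarrow> 'h \<Rightarrow> 'k" and x
  assume T: "\<And>b n. linear_on H (*) (\<lambda>a. T a b n)" "\<And>a n. linear_on H (*) (\<lambda>b. T a b n)"
    "\<And>a b. linear_on H (*) (T a b)"
  show "sw x (\<lambda>a n. sw a (\<lambda>a1 a2. T a1 a2 n)) = sw x (\<lambda>a n. sw n (T a))"
    by (rule sw_coassoc_form) (rule T)+
next
  fix \<beta> :: "'h \<Rightarrow> 'h \<Rightarrow> 'k" and h x
  assume \<beta>: "\<And>n. linear_on H (*) (\<lambda>a. \<beta> a n)" "\<And>a. linear_on H (*) (\<beta> a)"
  let ?S = "antipode H"
  note vt = vector_space_times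
  note lin = lin linear_on_comp[OF \<beta>(1) _ UNIV_H] linear_on_comp[OF \<beta>(2) _ UNIV_H]
  let ?B = "\<lambda>m1 m2 p1 p2 q1 q2 h2. \<beta> (p1 * m1 * (?S q2 * h2)) (p2 * m2 * ?S q1)"
  \<comment> \<open>\<open>\<Delta>(p x S(q)) = p\<^sub>1 x\<^sub>1 S(q\<^sub>2) \<otimes> p\<^sub>2 x\<^sub>2 S(q\<^sub>1)\<close> for \<open>p \<otimes> q = \<Delta>(h\<^sub>1)\<close>\<close>
  have act: "sw (adjoint_act h1 x) (\<lambda>a. \<beta> (a * h2)) = sw h1 (\<lambda>p q. sw p (\<lambda>p1 p2. sw q (\<lambda>q1 q2.
      sw x (\<lambda>m1 m2. ?B m1 m2 p1 p2 q1 q2 h2))))" for h1 h2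
  proof -
    have "sw (adjoint_act h1 x) (\<lambda>a. \<beta> (a * h2)) = sw h1 (\<lambda>p q. sw (p * x * ?S q) (\<lambda>a n. \<beta> (a * h2) n))"
      unfolding adjoint_act_def
      by (rule linear_H_sweedler[where s = "(*)" and f = "\<lambda>z. sw z (\<lambda>a n. \<beta> (a * h2) n)"]) (intro lin)
    also have "\<dots> = sw h1 (\<lambda>p q. sw p (\<lambda>p1 p2. sw x (\<lambda>m1 m2. sw (?S q) (\<lambda>u v. \<beta> (p1 * m1 * u * h2) (p2 * m2 * v)))))"
      by (subst sw_mult[OF vt], (intro lin)+, subst sw_mult[OF vt], (intro lin refl)+)
    also have "\<dots> = sw h1 (\<lambda>p q. sw p (\<lambda>p1 p2. sw x (\<lambda>m1 m2. sw q (\<lambda>q1 q2. \<beta> (p1 * m1 * ?S q2 * h2) (p2 * m2 * ?S q1)))))"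
      by (subst sw_antipode[OF vt]) (intro lin refl)+
    also have "\<dots> = sw h1 (\<lambda>p q. sw p (\<lambda>p1 p2. sw q (\<lambda>q1 q2. sw x (\<lambda>m1 m2. ?B m1 m2 p1 p2 q1 q2 h2))))"
      by (subst (3) sweedler_swap) (simp only: mult.assoc)
    finally show ?thesis .
  qed
  let ?C = "\<lambda>p1 p2 q1 q2 h2. sw x (\<lambda>m1 m2. ?B m1 m2 p1 p2 q1 q2 h2)"
  have "sw h (\<lambda>h1 h2. sw (adjoint_act h1 x) (\<lambda>a. \<beta> (a * h2))) =
      sw h (\<lambda>h1 h2. sw h1 (\<lambda>p q. sw p (\<lambda>p1 p2. sw q (\<lambda>q1 q2. ?C p1 p2 q1 q2 h2))))"
    by (simp only: act)
  also have "\<dots> = sw h (\<lambda>p r. sw r (\<lambda>q h2. sw p (\<lambda>p1 p2. sw q (\<lambda>q1 q2. ?C p1 p2 q1 q2 h2))))"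
    by (rule sw_coassoc[OF vt]) (intro lin)+
  also have "\<dots> = sw h (\<lambda>p r. sw p (\<lambda>p1 p2. sw r (\<lambda>q h2. sw q (\<lambda>q1 q2. ?C p1 p2 q1 q2 h2))))"
    by (subst sweedler_swap) (rule refl)
  also have "\<dots> = sw h (\<lambda>p r. sw p (\<lambda>p1 p2. sw r (\<lambda>q1 w. sw w (\<lambda>q2 h2. ?C p1 p2 q1 q2 h2))))"
    by (subst sw_coassoc[OF vt]) (intro lin refl)+
  \<comment> \<open>now \<open>S(q\<^sub>2)\<close> and \<open>h\<^sub>2\<close> come from adjacent tensor factors and cancel\<close>
  also have "\<dots> = sw h (\<lambda>p r. sw p (\<lambda>p1 p2. sw r (\<lambda>q1 w. counit H w * (sw x (\<lambda>m1 m2. \<beta> (p1 * m1 * 1) (p2 * m2 * ?S q1))))))"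
    by (subst sw_antipode_left[where s = "(*)"]) (intro lin refl)+
  also have "\<dots> = sw h (\<lambda>p r. sw p (\<lambda>p1 p2. sw x (\<lambda>m1 m2. \<beta> (p1 * m1 * 1) (p2 * m2 * ?S r))))"
    by (subst sw_counit_right) (intro lin refl)+
  also have "\<dots> = sw h (\<lambda>p1 r. sw r (\<lambda>p2 q. sw x (\<lambda>m1 m2. \<beta> (p1 * m1 * 1) (p2 * m2 * ?S q))))"
    by (rule sw_coassoc[OF vt]) (intro lin)+
  also have "\<dots> = sw h (\<lambda>p1 r. sw x (\<lambda>m1 m2. sw r (\<lambda>p2 q. \<beta> (p1 * m1 * 1) (p2 * m2 * ?S q))))"
    by (subst sweedler_swap) (rule refl)
  also have "\<dots> = sw h (\<lambda>p1 r. sw x (\<lambda>m1 m2. \<beta> (p1 * m1) (adjoint_act r m2)))"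
    unfolding adjoint_act_def
    by (simp add: linear_H_sweedler[OF \<beta>(2)])
  finally show "sw h (\<lambda>h1 h2. sw (adjoint_act h1 x) (\<lambda>a. \<beta> (a * h2))) =
    sw h (\<lambda>h1 h2. sw x (\<lambda>a n. \<beta> (h1 * a) (adjoint_act h2 n)))" .
qed

lemma sweedler_coadjoint_coact:
  assumes s: "vector_space s"
    and \<phi>: "\<And>y. linear_on H s (\<lambda>x. \<phi> x y)" "\<And>x. linear_on H s (\<lambda>y. \<phi> x y)"
  shows "sweedler H H (coadjoint_coact x) \<phi> = sw x (\<lambda>x1 y. sw y (\<lambda>x2 x3. \<phi> (x1 * antipode H x3) x2))"
  unfolding coadjoint_coact_def
  by (simp add: sweedler_sweedler[OF vspace_H s bilinear_HI] sweedler_pure[OF s bilinear_HI] \<phi>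
    sweedler_in_tensor_space pure_in_tensor_space)

lemma left_yetter_drinfeld_regular: "left_yetter_drinfeld H (*) coadjoint_coact"
proof (unfold_locales)
  fix x a b h
  show "linear_on H (vscale H) (\<lambda>h. h * x)" "linear_on H (vscale H) ((*) h)"
    by (intro lin)+
  show "1 * x = x" "a * b * x = a * (b * x)" by (simp_all add: mult.assoc)
  show "linear_on H tscale coadjoint_coact" unfolding coadjoint_coact_def by (intro lin)
  show "coadjoint_coact x \<in> vcarrier (H \<otimes>\<^sub>v H)" unfolding coadjoint_coact_def
    by (intro sweedler_in_tensor_space pure_in_tensor_space UNIV_H)
  have "sweedler H H (coadjoint_coact x) (\<lambda>a y. vscale H (counit H a) y) =
      sw x (\<lambda>x1 y. sw y (\<lambda>x2 x3. vscale H (counit H (x1 * antipode H x3)) x2))"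
    by (rule sweedler_coadjoint_coact[OF vector_space]) (intro lin)+
  also have "\<dots> = sw x (\<lambda>x1 y. sw y (\<lambda>x2 x3. vscale H (counit H x3) (vscale H (counit H x1) x2)))"
    by (simp add: counit_mult counit_antipode vector_space.vector_space_assms(3)[OF vector_space] mult.commute)
  also have "\<dots> = sw x (\<lambda>x1 y. vscale H (counit H x1) y)"
    by (subst sw_counit_right) (intro lin refl)+
  finally show "sweedler H H (coadjoint_coact x) (\<lambda>a. vscale H (counit H a)) = x"
    by (simp add: counit_left)
next
  fix T :: "'h \<Rightarrow> 'h \<Rightarrow> 'h \<Rightarrow> 'k" and x
  assume T: "\<And>b n. linear_on H (*) (\<lambda>a. T a b n)" "\<And>a n. linear_on H (*) (\<lambda>b. T a b n)"
    "\<And>a b. linear_on H (*) (T a b)"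
  let ?S = "antipode H" and ?D = "\<lambda>x. sweedler H H (coadjoint_coact x)"
  note vt = vector_space_times
  note lin = lin linear_on_comp[OF T(1) _ UNIV_H] linear_on_comp[OF T(2) _ UNIV_H] linear_on_comp[OF T(3) _ UNIV_H]
  \<comment> \<open>both sides are the sum of \<open>T (x\<^sub>1 S(x\<^sub>5)) (x\<^sub>2 S(x\<^sub>4)) x\<^sub>3\<close>\<close>
  have "?D x (\<lambda>a n. sw a (\<lambda>a1 a2. T a1 a2 n)) =
      sw x (\<lambda>x1 y. sw y (\<lambda>x2 x3. sw (x1 * ?S x3) (\<lambda>a1 a2. T a1 a2 x2)))"
    by (rule sweedler_coadjoint_coact[OF vt]) (intro lin)+
  also have "\<dots> = sw x (\<lambda>x1 y. sw y (\<lambda>x2 x3. sw x1 (\<lambda>p q. sw (?S x3) (\<lambda>u v. T (p * u) (q * v) x2))))"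
    by (subst sw_mult[OF vt]) (intro lin refl)+
  also have "\<dots> = sw x (\<lambda>x1 y. sw y (\<lambda>x2 x3. sw x1 (\<lambda>p q. sw x3 (\<lambda>r t. T (p * ?S t) (q * ?S r) x2))))"
    by (subst sw_antipode[OF vt]) (intro lin refl)+
  also have "\<dots> = sw x (\<lambda>x1 y. sw x1 (\<lambda>p q. sw y (\<lambda>x2 x3. sw x3 (\<lambda>r t. T (p * ?S t) (q * ?S r) x2))))"
    by (subst (2) sweedler_swap) (rule refl)
  also have "\<dots> = sw x (\<lambda>p z. sw z (\<lambda>q y. sw y (\<lambda>x2 x3. sw x3 (\<lambda>r t. T (p * ?S t) (q * ?S r) x2))))"
    by (rule sw_coassoc[OF vt]) (intro lin)+
  finally have 1: "?D x (\<lambda>a n. sw a (\<lambda>a1 a2. T a1 a2 n)) = \<dots>" .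
  have D: "?D n (T a) = sw n (\<lambda>p z. sw z (\<lambda>q r. T a (p * ?S r) q))" for n a
    by (rule sweedler_coadjoint_coact[OF vt]) (intro lin)+
  have "?D x (\<lambda>a n. ?D n (T a)) = sw x (\<lambda>x1 y. sw y (\<lambda>w x3. sw w (\<lambda>p z. sw z (\<lambda>q r. T (x1 * ?S x3) (p * ?S r) q))))"
    unfolding D by (rule sweedler_coadjoint_coact[OF vt]) (intro lin)+
  also have "\<dots> = sw x (\<lambda>x1 y. sw y (\<lambda>p w. sw w (\<lambda>z x3. sw z (\<lambda>q r. T (x1 * ?S x3) (p * ?S r) q))))"
    by (subst sw_coassoc[OF vt, where T = "\<lambda>p z x3. sw z (\<lambda>q r. T (_ * ?S x3) (p * ?S r) q)"]) (intro lin refl)+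
  also have "\<dots> = sw x (\<lambda>x1 y. sw y (\<lambda>p w. sw w (\<lambda>q z. sw z (\<lambda>r x3. T (x1 * ?S x3) (p * ?S r) q))))"
    by (subst sw_coassoc[OF vt, where T = "\<lambda>q r x3. T (_ * ?S x3) (_ * ?S r) q"]) (intro lin refl)+
  finally show "?D x (\<lambda>a n. sw a (\<lambda>a1 a2. T a1 a2 n)) = ?D x (\<lambda>a n. ?D n (T a))"
    using 1 by simp
next
  fix \<beta> :: "'h \<Rightarrow> 'h \<Rightarrow> 'k" and h x
  assume \<beta>: "\<And>n. linear_on H (*) (\<lambda>a. \<beta> a n)" "\<And>a. linear_on H (*) (\<beta> a)"
  let ?S = "antipode H" and ?D = "\<lambda>x. sweedler H H (coadjoint_coact x)"
  note vt = vector_space_times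
  note lin = lin linear_on_comp[OF \<beta>(1) _ UNIV_H] linear_on_comp[OF \<beta>(2) _ UNIV_H]
  let ?C = "\<lambda>p q r k. sw x (\<lambda>x1 y. sw y (\<lambda>x2 x3. \<beta> (p * x1 * (?S x3 * (?S r * k))) (q * x2)))"
  \<comment> \<open>since \<open>S(r x\<^sub>3) = S(x\<^sub>3) S(r)\<close>, the factor \<open>S(r)\<close> meets \<open>h\<^sub>2\<close>, with which it cancels below\<close>
  have D: "?D (h1 * x) (\<lambda>a. \<beta> (a * h2)) = sw h1 (\<lambda>p z. sw z (\<lambda>q r. ?C p q r h2))" for h1 h2
  proof -
    have "?D (h1 * x) (\<lambda>a. \<beta> (a * h2)) = sw (h1 * x) (\<lambda>u w. sw w (\<lambda>v w. \<beta> (u * ?S w * h2) v))"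
      by (rule sweedler_coadjoint_coact[OF vt]) (intro lin)+
    also have "\<dots> = sw h1 (\<lambda>p z. sw x (\<lambda>x1 y. sw (z * y) (\<lambda>v w. \<beta> (p * x1 * ?S w * h2) v)))"
      by (rule sw_mult[OF vt]) (intro lin)+
    also have "\<dots> = sw h1 (\<lambda>p z. sw x (\<lambda>x1 y. sw z (\<lambda>q r. sw y (\<lambda>x2 x3. \<beta> (p * x1 * ?S (r * x3) * h2) (q * x2)))))"
      by (subst sw_mult[OF vt]) (intro lin refl)+
    also have "\<dots> = sw h1 (\<lambda>p z. sw z (\<lambda>q r. ?C p q r h2))"
      by (subst (2) sweedler_swap) (simp only: antipode_mult mult.assoc)
    finally show ?thesis .
  qed
  have "sw h (\<lambda>h1 h2. ?D (h1 * x) (\<lambda>a. \<beta> (a * h2))) =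
      sw h (\<lambda>h1 h2. sw h1 (\<lambda>p z. sw z (\<lambda>q r. ?C p q r h2)))"
    by (simp only: D)
  also have "\<dots> = sw h (\<lambda>p w. sw w (\<lambda>z h2. sw z (\<lambda>q r. ?C p q r h2)))"
    by (rule sw_coassoc[OF vt]) (intro lin)+
  also have "\<dots> = sw h (\<lambda>p w. sw w (\<lambda>q z. sw z (\<lambda>r k. ?C p q r k)))"
    by (subst sw_coassoc[OF vt, where T = "\<lambda>q r k. ?C _ q r k"]) (intro lin refl)+
  also have "\<dots> = sw h (\<lambda>p w. sw w (\<lambda>q z. counit H z * sw x (\<lambda>x1 y. sw y (\<lambda>x2 x3. \<beta> (p * x1 * (?S x3 * 1)) (q * x2)))))"
    by (subst sw_antipode_left[where s = "(*)"]) (intro lin refl)+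
  also have "\<dots> = sw h (\<lambda>p q. sw x (\<lambda>x1 y. sw y (\<lambda>x2 x3. \<beta> (p * x1 * (?S x3 * 1)) (q * x2))))"
    by (subst sw_counit_right) (intro lin refl)+
  also have "\<dots> = sw h (\<lambda>p q. sw x (\<lambda>x1 y. sw y (\<lambda>x2 x3. \<beta> (p * (x1 * ?S x3)) (q * x2))))"
    by (simp add: mult.assoc)
  also have "\<dots> = sw h (\<lambda>p q. ?D x (\<lambda>a n. \<beta> (p * a) (q * n)))"
    by (subst sweedler_coadjoint_coact[OF vt]) (intro lin refl)+
  finally show "sw h (\<lambda>h1 h2. ?D (h1 * x) (\<lambda>a. \<beta> (a * h2))) =
    sw h (\<lambda>h1 h2. ?D x (\<lambda>a n. \<beta> (h1 * a) (h2 * n)))" .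
qed


section \<open>A symmetric braiding makes the Hopf algebra trivial\<close>

text \<open>
  On objects with trivial right structure the braiding is \<open>x \<otimes> y \<mapsto> x\<^sub>[\<^sub>-\<^sub>1\<^sub>] \<triangleright> y \<otimes> x\<^sub>[\<^sub>0\<^sub>]\<close>.
\<close>

lemma braiding_left_objects:
  assumes A: "embedded_left_yetter_drinfeld H \<alpha> \<delta> s j"
    and B: "embedded_left_yetter_drinfeld H \<alpha>' \<delta>' s j"
  shows "braiding H (left_object H s j \<alpha> \<delta>) (left_object H s j \<alpha>' \<delta>')
      (pure (left_object H s j \<alpha> \<delta>) (left_object H s j \<alpha>' \<delta>') (j x) (j y)) =
      sweedler H H (\<delta> x) (\<lambda>a x0.
        pure (left_object H s j \<alpha>' \<delta>') (left_object H s j \<alpha> \<delta>) (j (\<alpha>' a y)) (j x0))" (is ?braid)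
    and "linear_on (left_object H s j \<alpha> \<delta> \<otimes>\<^sub>v left_object H s j \<alpha>' \<delta>') tscale
      (braiding H (left_object H s j \<alpha> \<delta>) (left_object H s j \<alpha>' \<delta>'))" (is ?lin)
proof -
  interpret A: embedded_left_yetter_drinfeld H \<alpha> \<delta> s j by (rule A)
  interpret B: embedded_left_yetter_drinfeld H \<alpha>' \<delta>' s j by (rule B)
  note vt = vector_space_tscale
  let ?M = "A.M" and ?N = "B.M"
  note linM = A.linM B.linM
  let ?\<phi> = "\<lambda>m n. sweedler H ?M (lcoact ?M m) (\<lambda>a m0.
         sweedler ?N H (rcoact ?N n) (\<lambda>n0 b. pure ?N ?M (lact ?N a n0) (ract ?M m0 b)))"
  have inner: "sweedler ?N H (rcoact ?N (j y)) (\<lambda>n0 b. pure ?N ?M (lact ?N a n0) (ract ?M (j x) b)) =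
      pure ?N ?M (j (\<alpha>' a y)) (j x)" for a x y
  proof -
    have "sweedler ?N H (rcoact ?N (j y)) (\<lambda>n0 b. pure ?N ?M (lact ?N a n0) (ract ?M (j x) b)) =
        pure ?N ?M (lact ?N a (j y)) (ract ?M (j x) 1)"
      by (rule B.sweedler_rcoact[OF vt]) ((unfold A.M_ract B.M_lact)?, intro linM)+
    then show ?thesis
      by (simp add: A.M_ract B.M_lact counit_one A.j.vs1.scale_one)
  qed
  have \<phi>: "?\<phi> (j x) (j y) = sweedler H H (\<delta> x) (\<lambda>a x0. pure ?N ?M (j (\<alpha>' a y)) (j x0))" for x y
    by (subst A.sweedler_lcoact[OF vt]) ((unfold inner)?, intro linM refl)+
  have bil: "bilinear_on ?M ?N tscale ?\<phi>"
    unfolding bilinear_on_def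
  proof (intro conjI ballI)
    fix n assume "n \<in> vcarrier ?N"
    then obtain y where n: "n = j y" by (auto simp: B.M_vcarrier)
    show "linear_on ?M tscale (\<lambda>m. ?\<phi> m n)"
      unfolding n by (rule A.linear_MI) (unfold \<phi>, intro linM)
  next
    fix m assume "m \<in> vcarrier ?M"
    then obtain x where m: "m = j x" by (auto simp: A.M_vcarrier)
    show "linear_on ?N tscale (\<lambda>n. ?\<phi> m n)"
      unfolding m by (rule B.linear_MI) (unfold \<phi>, intro linM)
  qed
  show ?braid
    unfolding braiding_def
    by (subst sweedler_pure[OF vt bil]) (simp_all only: A.M_carrier_j B.M_carrier_j \<phi>)
  show ?lin
    unfolding braiding_def by (rule sweedler_linear[OF A.vspace_M vt bil])
qed

lemma symmetric_imp_scalar: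
  fixes s :: "'k \<Rightarrow> 'u::ab_group_add \<Rightarrow> 'u"
  assumes j: "Vector_Spaces.linear (vscale H) s j" "inj j"
    and sym: "\<And>(M :: ('k, 'h, 'u) bimod) (N :: ('k, 'h, 'u) bimod) t.
      yetter_drinfeld_long H M \<Longrightarrow> yetter_drinfeld_long H N \<Longrightarrow> t \<in> vcarrier (M \<otimes>\<^sub>v N) \<Longrightarrow>
      braiding H N M (braiding H M N t) = t"
  shows "x = vscale H (counit H x) 1"
proof (rule eq_if_functionals_eq[OF vector_space])
  fix f assume f: "Vector_Spaces.linear (vscale H) ((*) :: 'k \<Rightarrow> 'k \<Rightarrow> 'k) f"
  interpret f: Vector_Spaces.linear "vscale H" "(*)" f by (rule f)
  have A: "embedded_left_yetter_drinfeld H adjoint_act (comult H) s j"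
    and B: "embedded_left_yetter_drinfeld H (*) coadjoint_coact s j"
    by (simp_all add: embedded_left_yetter_drinfeld_def embedded_left_yetter_drinfeld_axioms_def
      left_yetter_drinfeld_adjoint left_yetter_drinfeld_regular j)
  interpret A: embedded_left_yetter_drinfeld H adjoint_act "comult H" s j by (rule A)
  interpret B: embedded_left_yetter_drinfeld H "(*)" coadjoint_coact s j by (rule B)
  let ?M = "A.M" and ?N = "B.M"
  \<comment> \<open>the counit on the first factor and f on the second\<close>
  let ?\<beta> = "\<lambda>u v. counit H (inv j u) * f (inv j v)"
  have "bilinear_on ?M ?N (*) ?\<beta>"
    unfolding bilinear_on_def
  proof (intro conjI ballI)
    show "linear_on ?M (*) (\<lambda>u. ?\<beta> u v)" for v
      by (rule A.linear_MI) (unfold inv_f_f[OF j(2)], intro lin)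
    show "linear_on ?N (*) (\<lambda>v. ?\<beta> u v)" for u
      by (rule B.linear_MI) (unfold inv_f_f[OF j(2)], intro lin lin_functional[OF f])
  qed
  then have \<beta>: "pure ?M ?N (j a) (j b) ?\<beta> = counit H a * f b" for a b
    by (simp add: pure_def j(2))
  have "braiding H ?N ?M (braiding H ?M ?N (pure ?M ?N (j x) (j 1))) =
      braiding H ?N ?M (sw x (\<lambda>a x0. pure ?N ?M (j (a * 1)) (j x0)))"
    by (subst braiding_left_objects(1)[OF A B]) (rule refl)
  also have "\<dots> = sw x (\<lambda>a x0. braiding H ?N ?M (pure ?N ?M (j (a * 1)) (j x0)))"
    by (rule linear_on_sweedler[OF vspace_tensor_space braiding_left_objects(2)[OF B A]])
      (intro A.linM B.linM)
  also have "\<dots> = sw x (\<lambda>a x0. sweedler H H (coadjoint_coact (a * 1)) (\<lambda>b y0. pure ?M ?N (j (adjoint_act b x0)) (j y0)))"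
    by (subst braiding_left_objects(1)[OF B A]) (rule refl)
  finally have "braiding H ?N ?M (braiding H ?M ?N (pure ?M ?N (j x) (j 1))) = \<dots>" .
  moreover have "braiding H ?N ?M (braiding H ?M ?N (pure ?M ?N (j x) (j 1))) = pure ?M ?N (j x) (j 1)"
    by (intro sym A.yetter_drinfeld_long_M B.yetter_drinfeld_long_M pure_in_tensor_space
      A.M_carrier_j B.M_carrier_j)
  ultimately have sq: "pure ?M ?N (j x) (j 1) =
      sw x (\<lambda>a x0. sweedler H H (coadjoint_coact (a * 1)) (\<lambda>b y0. pure ?M ?N (j (adjoint_act b x0)) (j y0)))"
    by (simp only:)
  have "counit H x * f 1 =
      sw x (\<lambda>a x0. sweedler H H (coadjoint_coact a) (\<lambda>b y0. counit H (adjoint_act b x0) * f y0))"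
    using fun_cong[OF sq, of ?\<beta>] unfolding sweedler_apply \<beta> mult_1_right .
  also have "\<dots> = sw x (\<lambda>a x0. sweedler H H (coadjoint_coact a) (\<lambda>b y0. counit H x0 * f (vscale H (counit H b) y0)))"
  proof -
    have "counit H (adjoint_act b x0) * f y0 = counit H x0 * f (vscale H (counit H b) y0)" for b x0 y0
      by (simp add: counit_adjoint_act f.scale)
    then show ?thesis by (simp only:)
  qed
  also have "\<dots> = sw x (\<lambda>a x0. counit H x0 * f a)"
  proof -
    have "sweedler H H (coadjoint_coact a) (\<lambda>b y0. c * f (vscale H (counit H b) y0)) =
        c * f (sweedler H H (coadjoint_coact a) (\<lambda>b y0. vscale H (counit H b) y0))" for a c
      by (rule sweedler_additive[symmetric]) (simp_all add: f.add f.zero distrib_left)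
    then show ?thesis by (simp only: B.coact_counit)
  qed
  also have "\<dots> = f x"
    by (rule sw_counit_right) (simp add: linear_on_def f.add f.scale)
  finally show "f x = f (vscale H (counit H x) 1)" by (simp add: f.scale)
qed

lemma hopf_iso_counit:
  assumes triv: "\<And>x. x = vscale H (counit H x) 1"
  shows "hopf_iso H trivial_hopf (counit H)"
proof -
  interpret vector_space "vscale H" by (rule vector_space)
  have sel: "vscale trivial_hopf = ((*) :: 'k \<Rightarrow> _)" "vcarrier trivial_hopf = (UNIV :: 'k set)"
    "counit trivial_hopf = (\<lambda>c::'k. c)" "antipode trivial_hopf = (\<lambda>c::'k. c)"
    by (simp_all add: trivial_hopf_def)
  have eps: "counit H (vscale H c 1) = c" for c
    using counit_linear by (simp add: linear_on_def vcarrier_UNIV counit_one)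
  let ?p = "pure trivial_hopf trivial_hopf :: 'k \<Rightarrow> 'k \<Rightarrow> ('k, 'k, 'k) tensor"
  have base: "pure base_field base_field = ?p"
    by (simp add: pure_def fun_eq_iff bilinear_on_def linear_on_def base_field_def sel)
  have "comult trivial_hopf = (\<lambda>c::'k. tscale c (pure base_field base_field 1 1))"
    by (simp add: trivial_hopf_def)
  then have comult: "comult trivial_hopf = (\<lambda>c::'k. tscale c (?p 1 1))"
    by (simp only: base)
  have p: "?p a b = tscale a (?p 1 b)" for a b
  proof -
    have "?p (a * 1) b = tscale a (?p 1 b)"
      using bilinear_on_pure[of "trivial_hopf :: ('k, 'k) hopf" "trivial_hopf :: ('k, 'k) hopf"]
      unfolding bilinear_on_def linear_on_def sel by blast
    then show ?thesis by simp
  qed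
  have "linear_on H tscale (\<lambda>y. ?p 1 (counit H y))"
    by (rule linear_on_pure_right) (use counit_linear in \<open>simp_all add: sel\<close>)
  then have c: "sw x (\<lambda>x1 x2. ?p (counit H x1) (counit H x2)) = ?p 1 (counit H x)" for x
    by (subst p) (rule sw_counit_left)
  have p': "?p 1 b = tscale b (?p 1 1)" for b
  proof -
    have "?p 1 (b * 1) = tscale b (?p 1 1)"
      using bilinear_on_pure[of "trivial_hopf :: ('k, 'k) hopf" "trivial_hopf :: ('k, 'k) hopf"]
      unfolding bilinear_on_def linear_on_def sel by blast
    then show ?thesis by simp
  qed
  show ?thesis
    unfolding hopf_iso_def
  proof (intro conjI allI)
    show "linear_on H (vscale trivial_hopf) (counit H)" using counit_linear by (simp add: sel)
    show "bij_betw (counit H) (vcarrier H) (vcarrier trivial_hopf)"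
      unfolding vcarrier_UNIV sel
      by (rule bij_betw_byWitness[where f' = "\<lambda>c. vscale H c 1"]) (simp_all add: eps flip: triv)
    show "comult trivial_hopf (counit H x) = sw x (\<lambda>x1 x2. ?p (counit H x1) (counit H x2))" for x
      unfolding c comult p'[of "counit H x"] ..
    show "antipode trivial_hopf (counit H x) = counit H (antipode H x)" for x
      by (simp add: sel counit_antipode)
  qed (simp_all add: counit_mult counit_one sel)
qed

section \<open>The braiding over the trivial Hopf algebra\<close>

lemma hopf_iso_trivial_imp_scalar:
  assumes "hopf_iso H trivial_hopf f"
  shows "x = vscale H (counit H x) 1"
proof -
  have f: "linear_on H (*) f" "inj f" "f 1 = 1" and eps: "\<And>x. counit H x = f x"
    using assms by (auto simp: hopf_iso_def trivial_hopf_def bij_betw_def vcarrier_UNIV)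
  have "f (vscale H (counit H x) 1) = f x"
    using f(1,3) eps by (simp add: linear_on_def vcarrier_UNIV)
  then show ?thesis using f(2) by (simp add: inj_eq)
qed

context
  assumes trivial: "\<And>x. x = vscale H (counit H x) 1"
begin

lemma lcoact_trivial:
  assumes M: "yetter_drinfeld_long H M" and m: "m \<in> vcarrier M"
  shows "lcoact M m = pure H M 1 m"
proof -
  have V: "vspace M" and l: "lcoact M m \<in> vcarrier (H \<otimes>\<^sub>v M)"
    and c: "sweedler H M (lcoact M m) (\<lambda>a n. vscale M (counit H a) n) = m"
    using M m unfolding yetter_drinfeld_long_def is_bicomodule_def by blast+
  interpret V: vector_space "vscale M" using V by (simp add: vspace_def)
  have sub: "V.subspace (vcarrier M)" using V by (simp add: vspace_def)
  have bil: "bilinear_on H M (vscale M) (\<lambda>a n. vscale M (counit H a) n)"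
    using counit_linear
    by (simp add: bilinear_on_def linear_on_def V.scale_left_distrib V.scale_right_distrib mult.commute)
  have P: "linear_on M tscale (pure H M 1)" "\<And>n. n \<in> vcarrier M \<Longrightarrow> linear_on H tscale (\<lambda>a. pure H M a n)"
    using bilinear_on_pure[of H M] by (simp_all add: bilinear_on_def)
  have one: "pure H M a n = pure H M 1 (vscale M (counit H a) n)" if n: "n \<in> vcarrier M" for a n
  proof -
    have "pure H M (vscale H (counit H a) 1) n = pure H M 1 (vscale M (counit H a) n)"
      using P(1) P(2)[OF n] n by (simp add: linear_on_def)
    then show ?thesis by (simp flip: trivial)
  qed
  obtain ps where ps: "set ps \<subseteq> vcarrier H \<times> vcarrier M" "lcoact M m = (\<Sum>(a, n)\<leftarrow>ps. pure H M a n)"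
    using tensor_space_decomp[OF vspace_H l] by blast
  have in_M: "vscale M (counit H a) n \<in> vcarrier M" if "(a, n) \<in> set ps" for a n
    using that ps(1) V.subspace_scale[OF sub] by blast
  have "map (\<lambda>(a, n). pure H M a n) ps = map (\<lambda>(a, n). pure H M 1 (vscale M (counit H a) n)) ps"
    using ps(1) one by (intro map_cong) auto
  then have "lcoact M m = (\<Sum>(a, n)\<leftarrow>ps. pure H M 1 (vscale M (counit H a) n))"
    by (simp only: ps(2))
  also have "\<dots> = pure H M 1 (\<Sum>(a, n)\<leftarrow>ps. vscale M (counit H a) n)"
    using linear_on_sum_list[OF V P(1) in_M] by (rule conjunct2[THEN sym])
  also have "(\<Sum>(a, n)\<leftarrow>ps. vscale M (counit H a) n) = m"
    using c sweedler_sum_pure[OF V.vector_space_axioms bil ps(1)] ps(2) by simp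
  finally show ?thesis .
qed

lemma rcoact_trivial:
  assumes M: "yetter_drinfeld_long H M" and m: "m \<in> vcarrier M"
  shows "rcoact M m = pure M H m 1"
proof -
  have V: "vspace M" and l: "rcoact M m \<in> vcarrier (M \<otimes>\<^sub>v H)"
    and c: "sweedler M H (rcoact M m) (\<lambda>n a. vscale M (counit H a) n) = m"
    using M m unfolding yetter_drinfeld_long_def is_bicomodule_def by blast+
  interpret V: vector_space "vscale M" using V by (simp add: vspace_def)
  have sub: "V.subspace (vcarrier M)" using V by (simp add: vspace_def)
  have bil: "bilinear_on M H (vscale M) (\<lambda>n a. vscale M (counit H a) n)"
    using counit_linear
    by (simp add: bilinear_on_def linear_on_def V.scale_left_distrib V.scale_right_distrib mult.commute)
  have P: "linear_on M tscale (\<lambda>n. pure M H n 1)" "\<And>n. n \<in> vcarrier M \<Longrightarrow> linear_on H tscale (pure M H n)"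
    using bilinear_on_pure[of M H] by (simp_all add: bilinear_on_def)
  have one: "pure M H n a = pure M H (vscale M (counit H a) n) 1" if n: "n \<in> vcarrier M" for a n
  proof -
    have "pure M H n (vscale H (counit H a) 1) = pure M H (vscale M (counit H a) n) 1"
      using P(1) P(2)[OF n] n by (simp add: linear_on_def)
    then show ?thesis by (simp flip: trivial)
  qed
  obtain ps where ps: "set ps \<subseteq> vcarrier M \<times> vcarrier H" "rcoact M m = (\<Sum>(n, a)\<leftarrow>ps. pure M H n a)"
    using tensor_space_decomp[OF V l] by blast
  have in_M: "vscale M (counit H a) n \<in> vcarrier M" if "(n, a) \<in> set ps" for a n
    using that ps(1) V.subspace_scale[OF sub] by blast
  have "map (\<lambda>(n, a). pure M H n a) ps = map (\<lambda>(n, a). pure M H (vscale M (counit H a) n) 1) ps"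
    using ps(1) one by (intro map_cong) auto
  then have "rcoact M m = (\<Sum>(n, a)\<leftarrow>ps. pure M H (vscale M (counit H a) n) 1)"
    by (simp only: ps(2))
  also have "\<dots> = pure M H (\<Sum>(n, a)\<leftarrow>ps. vscale M (counit H a) n) 1"
    using linear_on_sum_list[OF V P(1) in_M] by (rule conjunct2[THEN sym])
  also have "(\<Sum>(n, a)\<leftarrow>ps. vscale M (counit H a) n) = m"
    using c sweedler_sum_pure[OF V.vector_space_axioms bil ps(1)] ps(2) by simp
  finally show ?thesis .
qed

lemma braiding_trivial:
  assumes M: "yetter_drinfeld_long H M" and N: "yetter_drinfeld_long H N"
    and t: "t \<in> vcarrier (M \<otimes>\<^sub>v N)"
  shows "braiding H M N t = sweedler M N t (\<lambda>m n. pure N M n m)"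
proof -
  have V: "vspace M" "vspace N" and bm: "is_bimodule H M" "is_bimodule H N"
    using M N unfolding yetter_drinfeld_long_def by blast+
  note vt = vector_space_tscale
  have "sweedler H M (lcoact M m) (\<lambda>a m0. sweedler N H (rcoact N n)
      (\<lambda>n0 b. pure N M (lact N a n0) (ract M m0 b))) = pure N M n m"
    if m: "m \<in> vcarrier M" and n: "n \<in> vcarrier N" for m n
  proof -
    have inner: "sweedler N H (rcoact N n) (\<lambda>n0 b. pure N M (lact N a n0) (ract M m0 b)) =
        pure N M (lact N a n) m0" if m0: "m0 \<in> vcarrier M" for a m0
    proof -
      have "bilinear_on N H tscale (\<lambda>n0 b. pure N M (lact N a n0) (ract M m0 b))"
        using bm m0 bilinear_on_pure[of N M]
        by (simp add: is_bimodule_def bilinear_on_def linear_on_def)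
      then show ?thesis
        using bm m0 n by (simp add: rcoact_trivial[OF N n] sweedler_pure[OF vt] is_bimodule_def)
    qed
    have "bilinear_on H M tscale (\<lambda>a m0. pure N M (lact N a n) m0)"
      using bm n bilinear_on_pure[of N M]
      by (simp add: is_bimodule_def bilinear_on_def linear_on_def)
    moreover have "bilinear_on H M tscale (\<lambda>a m0. sweedler N H (rcoact N n)
        (\<lambda>n0 b. pure N M (lact N a n0) (ract M m0 b))) \<longleftrightarrow>
        bilinear_on H M tscale (\<lambda>a m0. pure N M (lact N a n) m0)"
      by (rule bilinear_on_cong[OF vspace_H V(1)]) (rule inner)
    ultimately show ?thesis
      using bm m n by (simp add: lcoact_trivial[OF M m] sweedler_pure[OF vt] inner is_bimodule_def)
  qed
  then show ?thesis
    unfolding braiding_def by (rule sweedler_cong[OF V(1) t])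
qed

lemma braiding_involutive_trivial:
  assumes M: "yetter_drinfeld_long H M" and N: "yetter_drinfeld_long H N"
    and t: "t \<in> vcarrier (M \<otimes>\<^sub>v N)"
  shows "braiding H N M (braiding H M N t) = t"
proof -
  have V: "vspace M" "vspace N" using M N unfolding yetter_drinfeld_long_def by blast+
  note vt = vector_space_tscale
  have bil: "bilinear_on V W tscale (\<lambda>v w. pure W V w v)" for V :: "('k, 'p::ab_group_add, 'x) vsp_scheme"
    and W :: "('k, 'q::ab_group_add, 'y) vsp_scheme"
    using bilinear_on_pure[of W V] by (simp add: bilinear_on_def)
  obtain ps where ps: "set ps \<subseteq> vcarrier M \<times> vcarrier N" "t = (\<Sum>(m, n)\<leftarrow>ps. pure M N m n)"
    using tensor_space_decomp[OF V(1) t] by blast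
  let ?qs = "map (\<lambda>(m, n). (n, m)) ps"
  have qs: "set ?qs \<subseteq> vcarrier N \<times> vcarrier M" using ps(1) by auto
  have "braiding H M N t = (\<Sum>(m, n)\<leftarrow>ps. pure N M n m)"
    unfolding braiding_trivial[OF M N t] unfolding ps(2) by (rule sweedler_sum_pure[OF vt bil ps(1)])
  also have "\<dots> = (\<Sum>(n, m)\<leftarrow>?qs. pure N M n m)"
    by (simp add: comp_def case_prod_unfold)
  finally have b: "braiding H M N t = (\<Sum>(n, m)\<leftarrow>?qs. pure N M n m)" .
  have "braiding H N M (braiding H M N t) = sweedler N M (\<Sum>(n, m)\<leftarrow>?qs. pure N M n m) (\<lambda>n m. pure M N m n)"
  proof -
    have "braiding H M N t \<in> vcarrier (N \<otimes>\<^sub>v M)"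
      unfolding b using qs by (rule sum_pure_in_tensor_space)
    then show ?thesis using braiding_trivial[OF N M] b by simp
  qed
  also have "\<dots> = (\<Sum>(n, m)\<leftarrow>?qs. pure M N m n)"
    by (rule sweedler_sum_pure[OF vt bil qs])
  also have "\<dots> = t"
    by (simp add: ps(2) comp_def case_prod_unfold)
  finally show ?thesis .
qed

end
end

theorem theorem3p1:
  fixes H :: "('k::field, 'h::ring_1) hopf"
  assumes "hopf_algebra H"
    and "bij (antipode H)"
    and universe: "\<exists>(s :: 'k \<Rightarrow> 'u \<Rightarrow> 'u) (j :: 'h \<Rightarrow> 'u::ab_group_add). Vector_Spaces.linear (vscale H) s j \<and> inj j"
  shows
    "(\<forall>(M :: ('k, 'h, 'u) bimod) (N :: ('k, 'h, 'u) bimod).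
        yetter_drinfeld_long H M \<and> yetter_drinfeld_long H N \<longrightarrow>
        (\<forall>t \<in> vcarrier (M \<otimes>\<^sub>v N). braiding H N M (braiding H M N t) = t))
     \<longleftrightarrow> (\<exists>f. hopf_iso H trivial_hopf f)"
proof
  interpret hopf_algebra H by fact
  obtain s :: "'k \<Rightarrow> 'u \<Rightarrow> 'u" and j where j: "Vector_Spaces.linear (vscale H) s j" "inj j"
    using universe by blast
  assume "\<forall>(M :: ('k, 'h, 'u) bimod) (N :: ('k, 'h, 'u) bimod).
      yetter_drinfeld_long H M \<and> yetter_drinfeld_long H N \<longrightarrow>
      (\<forall>t \<in> vcarrier (M \<otimes>\<^sub>v N). braiding H N M (braiding H M N t) = t)"
  then have "x = vscale H (counit H x) 1" for x
    by (intro symmetric_imp_scalar[OF j]) blast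
  then have "hopf_iso H trivial_hopf (counit H)" by (rule hopf_iso_counit)
  then show "\<exists>f. hopf_iso H trivial_hopf f" by (intro exI[of _ "counit H"])
next
  interpret hopf_algebra H by fact
  assume "\<exists>f. hopf_iso H trivial_hopf f"
  then obtain f where "hopf_iso H trivial_hopf f" by blast
  then have "x = vscale H (counit H x) 1" for x
    by (rule hopf_iso_trivial_imp_scalar)
  then show "\<forall>(M :: ('k, 'h, 'u) bimod) (N :: ('k, 'h, 'u) bimod).
      yetter_drinfeld_long H M \<and> yetter_drinfeld_long H N \<longrightarrow>
      (\<forall>t \<in> vcarrier (M \<otimes>\<^sub>v N). braiding H N M (braiding H M N t) = t)"
    by (intro allI impI ballI braiding_involutive_trivial) simp_all
qed

end
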